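(* In a single-item, single-buyer market, the revenue approximation ratio of (single, deterministic) price-posting mechanisms is: $0$ over general value distributions; between $0.8246$ and $0.8532$ over quasi-regular value distributions; and $1$ over regular value distributions.
   Context: Single seller with one item of zero cost, one buyer with quasi-linear utility and value from $F$ (satisfying: support $[v_L,v_H]$ or $[v_L,\infty)$, atomless except possibly at $v_H$, CDF differentiable on the interior with density $f$, some price maximizing $p(1-F(p))$). $\mathfrak M$: Bayesian incentive compatible, interim individually rational mechanisms with all payments going to the seller; $\Pi_F(M)$ = expected seller revenue, $U_F(M)$ = expected buyer utility. $\mathfrak M^\dagger\subset\mathfrak M$ is the class of mechanisms posting one deterministic take-it-or-leave-it price. For a class $\mathcal F$ of distributions, the revenue approximation ratio of $\mathfrak M^\dagger$ is $$\inf_{F\in\mathcal F,\,U}\frac{\sup\{\Pi_F(M):M\in\mathfrak M^\dagger,\ U_F(M)\ge U\}}{\sup\{\Pi_F(M):M\in\mathfrak M,\ U_F(M)\ge U\}},$$ with $U$ ranging over achievable buyer-surplus levels. Quantile $q=1-F(v)$, $v(q)=\inf\{v:F(v)>1-q\}$, revenue curve $R(q)=qv(q)$. $F$ is regular if $v-\frac{1-F(v)}{f(v)}$ is nondecreasing; $F$ is quasi-regular if $\frac{R(q')}{1-q'}\ge\frac{R(q)}{1-q}$ for all $0\le q<q'<1$. *)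

theory Defs
  imports "HOL-Probability.Probability"
begin

definition val_set :: "real \<Rightarrow> ereal \<Rightarrow> real set" where
  "val_set vL vH = {v. vL \<le> v \<and> ereal v \<le> vH}"

definition standard_dist :: "real measure \<Rightarrow> real \<Rightarrow> ereal \<Rightarrow> bool" where
  "standard_dist M vL vH \<longleftrightarrow>
     real_distribution M \<and> 0 \<le> vL \<and> ereal vL < vH \<and>
     \<comment> \<open>support is exactly [vL,vH] (resp. [vL,infinity))\<close>
     measure M (val_set vL vH) = 1 \<and>
     (\<forall>a b. vL \<le> a \<longrightarrow> a < b \<longrightarrow> ereal b \<le> vH \<longrightarrow> measure M {a<..<b} > 0) \<and>
     \<comment> \<open>atomless except possibly at vH\<close>
     (\<forall>x. ereal x \<noteq> vH \<longrightarrow> measure M {x} = 0) \<and>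
     \<comment> \<open>CDF differentiable on the interior of the support\<close>
     (\<forall>x. vL < x \<longrightarrow> ereal x < vH \<longrightarrow> cdf M differentiable (at x)) \<and>
     \<comment> \<open>some price maximizes p (1 - F p)\<close>
     (\<exists>p. \<forall>p'. p' * (1 - cdf M p') \<le> p * (1 - cdf M p))"

definition admissible_dist :: "real measure \<Rightarrow> bool" where
  "admissible_dist M \<longleftrightarrow> (\<exists>vL vH. standard_dist M vL vH)"

definition regular_dist :: "real measure \<Rightarrow> bool" where
  "regular_dist M \<longleftrightarrow> (\<exists>vL vH. standard_dist M vL vH \<and>
     mono_on {x. vL < x \<and> ereal x < vH} (\<lambda>v. v - (1 - cdf M v) / deriv (cdf M) v))"

definition quantile_val :: "real measure \<Rightarrow> real \<Rightarrow> real" where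
  "quantile_val M q = Inf {v. cdf M v > 1 - q}"

definition rev_curve :: "real measure \<Rightarrow> real \<Rightarrow> real" where
  "rev_curve M q = (if q = 0 then 0 else q * quantile_val M q)"

definition quasi_regular_dist :: "real measure \<Rightarrow> bool" where
  "quasi_regular_dist M \<longleftrightarrow> admissible_dist M \<and>
     (\<forall>q q'. 0 \<le> q \<longrightarrow> q < q' \<longrightarrow> q' < 1 \<longrightarrow>
        rev_curve M q' / (1 - q') \<ge> rev_curve M q / (1 - q))"

definition general_class :: "real measure set" where
  "general_class = {M. admissible_dist M}"
definition quasi_regular_class :: "real measure set" where
  "quasi_regular_class = {M. quasi_regular_dist M}"
definition regular_class :: "real measure set" where
  "regular_class = {M. admissible_dist M \<and> regular_dist M}"

definition supp :: "real measure \<Rightarrow> real set" where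
  "supp M = {v. \<forall>e>0. measure M {v - e<..<v + e} > 0}"

text \<open>Direct mechanisms (revelation principle): interim allocation probability x and
  expected payment t to the seller, as functions of the reported value.\<close>
type_synonym mech = "(real \<Rightarrow> real) \<times> (real \<Rightarrow> real)"

definition BIC_IR :: "real measure \<Rightarrow> mech set" where
  "BIC_IR M = {(x, t). x \<in> borel_measurable borel \<and> t \<in> borel_measurable borel \<and>
      integrable M t \<and>
      (\<forall>v\<in>supp M. 0 \<le> x v \<and> x v \<le> 1) \<and>
      (\<forall>v\<in>supp M. \<forall>w\<in>supp M. v * x v - t v \<ge> v * x w - t w) \<and>
      (\<forall>v\<in>supp M. v * x v - t v \<ge> 0)}"

definition revenue :: "real measure \<Rightarrow> mech \<Rightarrow> real" where
  "revenue M m = (\<integral>v. snd m v \<partial>M)"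

definition buyer_util :: "real measure \<Rightarrow> mech \<Rightarrow> ennreal" where
  "buyer_util M m = (\<integral>\<^sup>+v. ennreal (v * fst m v - snd m v) \<partial>M)"

definition posted_price :: "real \<Rightarrow> mech" where
  "posted_price p = ((\<lambda>v. if p \<le> v then 1 else 0), (\<lambda>v. if p \<le> v then p else 0))"

definition price_posting :: "real measure \<Rightarrow> mech set" where
  "price_posting M = BIC_IR M \<inter> range posted_price"

text \<open>Achievable buyer-surplus levels: 0 <= U < E[v] (maximal total surplus).\<close>
definition achievable :: "real measure \<Rightarrow> real \<Rightarrow> bool" where
  "achievable M U \<longleftrightarrow> 0 \<le> U \<and> ennreal U < (\<integral>\<^sup>+v. ennreal v \<partial>M)"

definition approx_ratio :: "real measure set \<Rightarrow> real" where
  "approx_ratio \<F> = Inf {Sup {revenue M m | m. m \<in> price_posting M \<and> buyer_util M m \<ge> ennreal U}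
                        / Sup {revenue M m | m. m \<in> BIC_IR M \<and> buyer_util M m \<ge> ennreal U}
                       | M U. M \<in> \<F> \<and> achievable M U}"

end

theory Submission
  imports Defs
begin

text \<open>
  Write \<open>G s\<close> for the probability of a value at least \<open>s\<close>, \<open>R s = s * G s\<close> for the revenue and \<open>W s\<close> for the
  buyer surplus of the posted price \<open>s\<close>, so that \<open>W' = - G\<close>.  Every mechanism is a limit of lotteries over
  posted prices, up to transfers to the buyer.  Hence for \<open>0 \<le> \<mu> \<le> 1\<close> a bound on \<open>R s + \<mu> * W s\<close> over all
  prices bounds revenue plus \<open>\<mu>\<close> times buyer surplus of every mechanism, and a lower bound on the ratio at
  the level \<open>U = W p\<close> only requires a multiplier \<open>\<mu>\<close> with \<open>R s + \<mu> * (W s - U) \<le> c * N\<close>, where \<open>N\<close> is the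
  best revenue among prices up to \<open>p\<close>.

  With \<open>\<gamma> s = s * f s / G s\<close> one has \<open>(R + \<mu> * W)' = G * (1 - \<mu> - \<gamma>)\<close>; for a regular distribution \<open>\<gamma>\<close>
  increases while the virtual value is negative, so \<open>\<mu> = 1 - \<gamma> p\<close> (or \<open>0\<close> above the monopoly price) makes
  \<open>p\<close> optimal and \<open>c = 1\<close> works.

  Quasi-regularity says that \<open>y\<close> is nondecreasing in \<open>G s = 1 / (1 + s * y s)\<close>.  Below \<open>p\<close> the demand is at
  most \<open>min 1 (N / s)\<close>, above \<open>p\<close> the revenue at \<open>s\<close> is bought by surplus at least
  \<open>ln ((1 + Y * s) / (1 + Y * p)) / Y\<close> with \<open>Y = y s\<close>, and \<open>\<mu> = (c - 1) / ln (p / N)\<close> reduces the claim to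
  an inequality in one variable.  Demand that attains these bounds, with prices scaled to \<open>N = 1\<close>,
  gives the upper bound.  For general distributions, equal revenue up to \<open>exp n\<close> followed by a slowly
  decreasing small demand makes the ratio tend to \<open>0\<close>.
\<close>

section \<open>Posted prices\<close>

locale valuation = real_distribution M for M +
  fixes vL :: real and vH :: ereal
  assumes std: "standard_dist M vL vH"
begin

lemma vL_nonneg: "0 \<le> vL" and vL_less: "ereal vL < vH"
  and prob_val_set: "prob (val_set vL vH) = 1"
  and prob_pos: "\<And>a b. vL \<le> a \<Longrightarrow> a < b \<Longrightarrow> ereal b \<le> vH \<Longrightarrow> 0 < prob {a<..<b}"
  and atomless: "\<And>x. ereal x \<noteq> vH \<Longrightarrow> prob {x} = 0"
  and cdf_diff: "\<And>x. vL < x \<Longrightarrow> ereal x < vH \<Longrightarrow> cdf M differentiable (at x)"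
  and monopoly: "\<exists>p. \<forall>p'. p' * (1 - cdf M p') \<le> p * (1 - cdf M p)"
  using std unfolding standard_dist_def by auto

lemma val_set_closed: "closed (val_set vL vH)"
proof -
  have "val_set vL vH = {vL..} \<inter> {v. ereal v \<le> vH}" by (auto simp: val_set_def)
  moreover have "closed {v. ereal v \<le> vH}"
    by (intro closed_Collect_le continuous_intros)
  ultimately show ?thesis by auto
qed

lemma AE_val: "AE v in M. v \<in> val_set vL vH"
  using AE_in_set_eq_1[of "val_set vL vH"] prob_val_set val_set_closed by auto

lemma val_nonneg: "v \<in> val_set vL vH \<Longrightarrow> 0 \<le> v"
  using vL_nonneg by (auto simp: val_set_def)

text \<open>Transfers the incentive constraints of \<open>BIC_IR\<close>, imposed on the topological
  support, to the interval \<open>val_set vL vH\<close>, which carries full measure.\<close>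

lemma supp_eq: "supp M = val_set vL vH"
proof (intro equalityI subsetI)
  fix v assume v: "v \<in> supp M"
  show "v \<in> val_set vL vH"
  proof (rule ccontr)
    assume "v \<notin> val_set vL vH"
    then have "v \<in> - val_set vL vH" by simp
    moreover have "open (- val_set vL vH)" using val_set_closed by auto
    ultimately obtain e where e: "e > 0" "ball v e \<subseteq> - val_set vL vH"
      using open_contains_ball by blast
    have "ball v e = {v-e<..<v+e}" by (auto simp: dist_real_def)
    with e have "\<And>x. x \<in> val_set vL vH \<Longrightarrow> x \<notin> {v-e<..<v+e}" by blast
    with AE_val have "AE x in M. x \<notin> {v-e<..<v+e}"
      by (rule eventually_mono)
    then have "prob {v-e<..<v+e} = 0"
      by (subst prob_eq_0) auto
    with v e show False by (auto simp: supp_def)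
  qed
next
  fix v assume v: "v \<in> val_set vL vH"
  show "v \<in> supp M"
    unfolding supp_def
  proof (intro CollectI allI impI)
    fix e :: real assume e: "e > 0"
    \<comment> \<open>Positive mass is known only for intervals inside the support, so the
      neighbourhood is cut to its right half at \<open>vL\<close> and to its left half elsewhere;
      the latter also serves \<open>vH\<close>.\<close>
    have "\<exists>a b. vL \<le> a \<and> a < b \<and> ereal b \<le> vH \<and> {a<..<b} \<subseteq> {v-e<..<v+e}"
    proof (cases "v = vL")
      case True
      have "ereal vL < min vH (ereal (vL + e))" using vL_less e by auto
      then obtain b where "ereal vL < ereal b" "ereal b < min vH (ereal (vL + e))"
        using ereal_dense2 by blast
      then show ?thesis using True e by (intro exI[of _ vL] exI[of _ b]) auto
    next
      case False
      then show ?thesis using v e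
        by (intro exI[of _ "max vL (v - e)"] exI[of _ v]) (auto simp: val_set_def)
    qed
    then obtain a b where ab: "vL \<le> a" "a < b" "ereal b \<le> vH" "{a<..<b} \<subseteq> {v-e<..<v+e}" by blast
    then have "0 < prob {a<..<b}" by (intro prob_pos)
    also have "\<dots> \<le> prob {v-e<..<v+e}" using ab by (intro finite_measure_mono) auto
    finally show "0 < measure M {v-e<..<v+e}" .
  qed
qed

text \<open>The closed ray counts an indifferent buyer as buying, as \<open>posted_price\<close>
  does. Hence an atom at \<open>vH\<close> is included in \<open>G\<close>, and \<open>G\<close>
  agrees with \<open>1 - cdf M\<close> away from \<open>vH\<close>.\<close>

definition G :: "real \<Rightarrow> real" where "G s = prob {s..}"
definition W :: "real \<Rightarrow> real" where "W s = (\<integral>v. max 0 (v - s) \<partial>M)"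
definition R :: "real \<Rightarrow> real" where "R s = s * G s"

lemma G_nonneg [simp]: "0 \<le> G s" and G_le_1 [simp]: "G s \<le> 1"
  by (auto simp: G_def)

lemma G_antimono: "a \<le> b \<Longrightarrow> G b \<le> G a"
  unfolding G_def by (intro finite_measure_mono) auto

lemma G_strict:
  assumes "vL \<le> a" "a < b" "ereal b \<le> vH" shows "G b < G a"
proof -
  have "G b < prob {a<..<b} + G b" using prob_pos[OF assms] by simp
  also have "\<dots> = prob ({a<..<b} \<union> {b..})" unfolding G_def
    by (intro finite_measure_Union[symmetric]) auto
  also have "\<dots> \<le> G a" unfolding G_def using assms by (intro finite_measure_mono) auto
  finally show ?thesis .
qed

lemma G_below: assumes "s \<le> vL" shows "G s = 1"
proof -
  have "prob (val_set vL vH) \<le> G s"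
    unfolding G_def using assms by (intro finite_measure_mono) (auto simp: val_set_def)
  then show ?thesis using prob_val_set G_le_1[of s] by linarith
qed

lemma G_pos: assumes "ereal s < vH" shows "0 < G s"
proof -
  have "ereal (max s vL) < vH" using assms vL_less by (auto simp: max_def)
  then obtain b where b: "ereal (max s vL) < ereal b" "ereal b < vH"
    using ereal_dense2 by blast
  then have "G b < G (max s vL)" by (intro G_strict) auto
  also have "\<dots> \<le> G s" by (intro G_antimono) auto
  finally show ?thesis using G_nonneg[of b] by linarith
qed

lemma G_cdf: assumes "ereal s \<noteq> vH" shows "G s = 1 - cdf M s"
proof -
  have "prob ({s} \<union> {s<..}) = prob {s} + prob {s<..}" "prob ({..s} \<union> {s<..}) = prob {..s} + prob {s<..}"
    by (intro finite_measure_Union; auto)+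
  moreover have "{s} \<union> {s<..} = {s..}" "{..s} \<union> {s<..} = UNIV" by auto
  ultimately show ?thesis using atomless[OF assms] prob_space by (simp add: cdf_def G_def)
qed

lemma eventually_neq_vH: assumes "ereal x \<noteq> vH" shows "eventually (\<lambda>s. ereal s \<noteq> vH) (nhds x)"
proof (cases vH)
  case (real r)
  then have "eventually (\<lambda>s. s \<noteq> r) (nhds x)" using assms
    by (intro t1_space_nhds) auto
  then show ?thesis using real by simp
qed (use assms in auto)

lemma G_cont: assumes "ereal x \<noteq> vH" shows "isCont G x"
proof -
  have "isCont (\<lambda>s. 1 - cdf M s) x"
    using atomless[OF assms] isCont_cdf by (intro continuous_intros) auto
  moreover have "eventually (\<lambda>s. G s = 1 - cdf M s) (nhds x)"
    using eventually_neq_vH[OF assms] by (rule eventually_mono) (rule G_cdf)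
  ultimately show ?thesis by (simp add: isCont_cong)
qed

lemma G_deriv: assumes "vL < x" "ereal x < vH"
  shows "(G has_real_derivative - deriv (cdf M) x) (at x)"
proof -
  have "(cdf M has_real_derivative deriv (cdf M) x) (at x)"
    using cdf_diff[OF assms] DERIV_deriv_iff_real_differentiable by blast
  then have "((\<lambda>s. 1 - cdf M s) has_real_derivative - deriv (cdf M) x) (at x)"
    by (auto intro!: derivative_eq_intros)
  moreover have "eventually (\<lambda>s. G s = 1 - cdf M s) (nhds x)"
    by (rule eventually_mono[OF eventually_neq_vH G_cdf]) (use assms(2) in auto)
  ultimately show ?thesis using DERIV_cong_ev[of x x G "\<lambda>s. 1 - cdf M s"] by blast
qed

text \<open>Extends revenue bounds to the top of the support, where an atom may make
  \<open>G\<close> discontinuous: \<open>G s\<close> is held fixed and only the price approaches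
  \<open>s\<close> from below.\<close>

lemma R_mono_limit:
  assumes "vL < s" and "\<And>x. vL < x \<Longrightarrow> x < s \<Longrightarrow> x * G s \<le> C"
  shows "s * G s \<le> C"
proof (rule tendsto_upperbound)
  show "((\<lambda>x. x * G s) \<longlongrightarrow> s * G s) (at_left s)" by (intro tendsto_intros)
  show "eventually (\<lambda>x. x * G s \<le> C) (at_left s)"
    using eventually_at_left[of vL s] assms by (auto intro!: exI[of _ vL])
qed simp

lemma R_bounded: "\<exists>C. \<forall>s. R s \<le> C"
proof -
  obtain p where p: "\<And>p'. p' * (1 - cdf M p') \<le> p * (1 - cdf M p)" using monopoly by blast
  have *: "s * G s \<le> p * (1 - cdf M p)" if "ereal s \<noteq> vH" for s
    using p[of s] G_cdf[OF that] by simp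
  have "R s \<le> p * (1 - cdf M p)" for s
  proof (cases "ereal s = vH")
    case True
    show ?thesis unfolding R_def
    proof (rule R_mono_limit)
      show "vL < s" using True vL_less by auto
      fix x assume x: "vL < x" "x < s"
      have "x * G s \<le> x * G x" using x vL_nonneg by (intro mult_left_mono G_antimono) auto
      also have "\<dots> \<le> p * (1 - cdf M p)" using x True by (intro *) auto
      finally show "x * G s \<le> p * (1 - cdf M p)" .
    qed
  qed (auto simp: R_def *)
  then show ?thesis by blast
qed

lemma AE_nonneg: "AE v in M. 0 \<le> v"
  using AE_val by (rule eventually_mono) (rule val_nonneg)

section \<open>Buyer surplus as a function of the price\<close>

lemma surplus_integrable [simp]:
  assumes "integrable M (\<lambda>v. v)" shows "integrable M (\<lambda>v. max 0 (v - s))"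
  using assms by (intro integrable_max) auto

lemma W_nonneg: "0 \<le> W s"
  unfolding W_def by (intro integral_nonneg_AE) auto

text \<open>Pointwise, \<open>max 0 (v - a) - max 0 (v - b)\<close> lies between
  \<open>b - a\<close> times the indicators of \<open>{b..}\<close> and of \<open>{a..}\<close>.
  This is the form of \<open>W' = - G\<close> that remains valid across an atom.\<close>

lemma W_diff:
  assumes "integrable M (\<lambda>v. v)" "a \<le> b"
  shows "(b - a) * G b \<le> W a - W b" "W a - W b \<le> (b - a) * G a"
proof -
  have *: "integrable M (\<lambda>v. indicat_real {x..} v * c)" for x c
    by (intro integrable_mult_left integrable_real_indicator) (auto simp: emeasure_eq_measure)
  have "(b - a) * G b = (\<integral>v. indicat_real {b..} v * (b - a) \<partial>M)" by (simp add: G_def)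
  also have "\<dots> \<le> (\<integral>v. max 0 (v - a) - max 0 (v - b) \<partial>M)"
    using assms by (intro integral_mono * Bochner_Integration.integrable_diff surplus_integrable)
      (auto simp: indicator_def max_def)
  also have "\<dots> = W a - W b"
    unfolding W_def using assms by (intro Bochner_Integration.integral_diff surplus_integrable)
  finally show "(b - a) * G b \<le> W a - W b" .
  have "W a - W b = (\<integral>v. max 0 (v - a) - max 0 (v - b) \<partial>M)"
    unfolding W_def using assms by (intro Bochner_Integration.integral_diff[symmetric] surplus_integrable)
  also have "\<dots> \<le> (\<integral>v. indicat_real {a..} v * (b - a) \<partial>M)"
    using assms by (intro integral_mono * Bochner_Integration.integrable_diff surplus_integrable)
      (auto simp: indicator_def max_def)
  also have "\<dots> = (b - a) * G a" by (simp add: G_def)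
  finally show "W a - W b \<le> (b - a) * G a" .
qed

lemma W_antimono:
  assumes "integrable M (\<lambda>v. v)" "a \<le> b" shows "W b \<le> W a"
proof -
  have "0 \<le> (b - a) * G b" using assms by simp
  then show ?thesis using W_diff(1)[OF assms] by linarith
qed

lemma W_strict:
  assumes "integrable M (\<lambda>v. v)" "a < b" "ereal b < vH" shows "W b < W a"
proof -
  have "0 < (b - a) * G b" using assms G_pos by simp
  then show ?thesis using W_diff(1)[OF assms(1), of a b] assms(2) by linarith
qed

lemma W_cont: assumes "integrable M (\<lambda>v. v)" shows "continuous_on A W"
proof -
  have "1-lipschitz_on UNIV W"
  proof (rule lipschitz_on_leI)
    fix x y :: real assume "x \<le> y"
    then have "0 \<le> W x - W y" "W x - W y \<le> (y - x) * G x"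
      using W_diff[OF assms] W_antimono[OF assms] by auto
    moreover have "(y - x) * G x \<le> (y - x) * 1"
      using \<open>x \<le> y\<close> by (intro mult_left_mono) auto
    ultimately show "dist (W x) (W y) \<le> 1 * dist x y" using \<open>x \<le> y\<close> by (simp add: dist_real_def)
  qed simp
  then show ?thesis using lipschitz_on_continuous_on continuous_on_subset by blast
qed

text \<open>By \<open>W_diff\<close> the difference quotient deviates from \<open>- G x\<close> by
  at most \<open>\<bar>G (x + h) - G x\<bar>\<close>, which vanishes because \<open>G\<close> is
  continuous at \<open>x\<close>.\<close>

lemma W_deriv:
  assumes "integrable M (\<lambda>v. v)" "ereal x \<noteq> vH"
  shows "(W has_real_derivative - G x) (at x)"
proof -
  have lim: "((\<lambda>h. - G (x + h)) \<longlongrightarrow> - G x) (at 0)"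
    using G_cont[OF assms(2)] by (intro tendsto_intros) (simp add: isCont_iff)
  have "((\<lambda>h. (W (x + h) - W x) / h + G x) \<longlongrightarrow> 0) (at 0)"
  proof (rule tendsto_rabs_zero_cancel, rule tendsto_sandwich[OF _ _ tendsto_const])
    show "((\<lambda>h. \<bar>- G (x + h) - - G x\<bar>) \<longlongrightarrow> 0) (at 0)"
      using LIM_zero[OF lim] by (rule tendsto_rabs_zero)
    have "\<bar>(W (x + h) - W x) / h + G x\<bar> \<le> \<bar>- G (x + h) - - G x\<bar>" if "h \<noteq> 0" for h
    proof (cases "h > 0")
      case True
      then have "G (x + h) \<le> (W x - W (x + h)) / h" "(W x - W (x + h)) / h \<le> G x"
        using W_diff[OF assms(1), of x "x + h"] by (auto simp: field_simps)
      moreover have "(W (x + h) - W x) / h = - ((W x - W (x + h)) / h)"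
        by (metis minus_diff_eq minus_divide_left)
      ultimately show ?thesis by linarith
    next
      case False
      then have h: "h < 0" using that by simp
      then have "G x \<le> (W x - W (x + h)) / h" "(W x - W (x + h)) / h \<le> G (x + h)"
        using W_diff[OF assms(1), of "x + h" x] by (auto simp: field_simps)
      moreover have "(W (x + h) - W x) / h = - ((W x - W (x + h)) / h)"
        by (metis minus_diff_eq minus_divide_left)
      ultimately show ?thesis by linarith
    qed
    then show "\<forall>\<^sub>F h in at 0. \<bar>(W (x + h) - W x) / h + G x\<bar> \<le> \<bar>- G (x + h) - - G x\<bar>"
      by (auto simp: eventually_at_filter)
  qed auto
  then have "((\<lambda>h. ((W (x + h) - W x) / h + G x) - G x) \<longlongrightarrow> 0 - G x) (at 0)"
    by (intro tendsto_intros)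
  then show ?thesis by (simp add: DERIV_def)
qed

lemma W_below: assumes "integrable M (\<lambda>v. v)" "s \<le> vL" shows "W s = (\<integral>v. v \<partial>M) - s"
proof -
  have "W s = (\<integral>v. v - s \<partial>M)" unfolding W_def
    using AE_val by (intro integral_cong_AE) (auto elim!: eventually_mono simp: val_set_def max_def dest: order_trans[OF assms(2)])
  then show ?thesis using assms prob_space by simp
qed

lemma W_tendsto: assumes "integrable M (\<lambda>v. v)" shows "(W \<longlongrightarrow> 0) at_top"
proof -
  have "((\<lambda>s. \<integral>v. max 0 (v - s) \<partial>M) \<longlongrightarrow> (\<integral>v. 0 \<partial>M)) at_top"
  proof (rule integral_dominated_convergence_at_top[where w="\<lambda>v. \<bar>v\<bar>"])
    show "integrable M (\<lambda>v. \<bar>v\<bar>)" using assms by simp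
    show "\<forall>\<^sub>F s in at_top. AE x in M. norm (max 0 (x - s)) \<le> \<bar>x\<bar>"
      using eventually_ge_at_top[of 0] by eventually_elim auto
    show "AE x in M. ((\<lambda>s. max 0 (x - s)) \<longlongrightarrow> 0) at_top"
    proof (rule AE_I2)
      fix x :: real
      show "((\<lambda>s. max 0 (x - s)) \<longlongrightarrow> 0) at_top"
        by (intro tendsto_eventually eventually_mono[OF eventually_ge_at_top[of x]]) auto
    qed
  qed auto
  then show ?thesis by (simp add: W_def[abs_def])
qed

text \<open>Intermediate values: \<open>W\<close> falls continuously from the mean at price 0 to 0
  at infinity. It already vanishes from \<open>vH\<close> on, hence \<open>p\<close> is below
  \<open>vH\<close>.\<close>

lemma W_level:
  assumes "integrable M (\<lambda>v. v)" "0 < U" "U < (\<integral>v. v \<partial>M)"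
  obtains p where "0 < p" "ereal p < vH" "W p = U"
proof -
  have "\<forall>\<^sub>F s in at_top. W s < U" using W_tendsto[OF assms(1)] assms(2) by (rule order_tendstoD)
  then obtain N where N: "\<And>s. s \<ge> N \<Longrightarrow> W s < U" by (auto simp: eventually_at_top_linorder)
  have "W 0 = (\<integral>v. v \<partial>M)" using W_below[OF assms(1), of 0] vL_nonneg by simp
  then have "\<exists>p\<ge>0. p \<le> max 0 N \<and> W p = U"
    using N[of "max 0 N"] assms by (intro IVT2' W_cont) auto
  then obtain p where p: "0 \<le> p" "W p = U" by blast
  have "p \<noteq> 0" using p \<open>W 0 = _\<close> assms by auto
  moreover have "ereal p < vH"
  proof (rule ccontr)
    assume *: "\<not> ereal p < vH"
    have "W p = (\<integral>v. 0 \<partial>M)" unfolding W_def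
    proof (intro integral_cong_AE)
      show "AE v in M. max 0 (v - p) = 0" using AE_val
      proof (rule eventually_mono)
        fix v assume "v \<in> val_set vL vH"
        then have "ereal v \<le> ereal p" using * order_trans[of "ereal v" vH "ereal p"] by (auto simp: val_set_def not_less)
        then show "max 0 (v - p) = 0" by simp
      qed
    qed auto
    then show False using p assms by simp
  qed
  ultimately show ?thesis using that[of p] p by simp
qed

section \<open>Revenue and surplus of posted-price mechanisms\<close>

lemma posted_BIC: "posted_price p \<in> BIC_IR M"
  unfolding BIC_IR_def posted_price_def
proof (intro CollectI case_prodI conjI ballI)
  show "integrable M (\<lambda>v. if p \<le> v then p else 0)"
    by (rule integrable_const_bound[where B="\<bar>p\<bar>"]) auto
qed auto

lemma posted_revenue: "revenue M (posted_price p) = R p"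
proof -
  have "(\<lambda>v. snd (posted_price p) v) = (\<lambda>v. indicat_real {p..} v * p)"
    by (auto simp: posted_price_def indicator_def)
  then show ?thesis by (simp add: revenue_def R_def G_def)
qed

lemma posted_util: "buyer_util M (posted_price p) = (\<integral>\<^sup>+v. ennreal (max 0 (v - p)) \<partial>M)"
  unfolding buyer_util_def posted_price_def by (intro nn_integral_cong) (auto simp: max_def)

lemma posted_util_finite:
  assumes "integrable M (\<lambda>v. v)"
  shows "buyer_util M (posted_price p) = ennreal (W p)"
  unfolding posted_util W_def using assms by (intro nn_integral_eq_integral) auto

text \<open>On the support \<open>v\<close> is dominated by
  \<open>max 0 (v - p) + \<bar>p\<bar>\<close>, so a finite surplus at a single price would force a
  finite mean.\<close>

lemma posted_util_infinite:
  assumes "\<not> integrable M (\<lambda>v. v)"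
  shows "buyer_util M (posted_price p) = \<infinity>"
proof (rule ccontr)
  assume "buyer_util M (posted_price p) \<noteq> \<infinity>"
  then have "integrable M (\<lambda>v. max 0 (v - p))" unfolding posted_util
    by (subst integrable_iff_bounded) (auto simp: top.not_eq_extremum)
  then have "integrable M (\<lambda>v. max 0 (v - p) + \<bar>p\<bar>)" by simp
  then have "integrable M (\<lambda>v. v)"
    by (rule Bochner_Integration.integrable_bound) (use AE_nonneg in \<open>auto elim!: eventually_mono\<close>)
  with assms show False by simp
qed

lemma mean_finite:
  assumes "integrable M (\<lambda>v. v)"
  shows "(\<integral>\<^sup>+v. ennreal v \<partial>M) = ennreal (\<integral>v. v \<partial>M)"
  using assms AE_nonneg by (rule nn_integral_eq_integral)

end

section \<open>Mechanisms as lotteries over prices\<close>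

text \<open>Counting the grid points \<open>j / n\<close> below \<open>x\<close> rounds
  \<open>x\<close> up to the grid: the indices below the ceiling of \<open>n * x\<close> all
  qualify.\<close>

lemma rounded_up_eq_card:
  fixes x :: real and n :: nat
  assumes "0 \<le> x" "x \<le> 1" "0 < n"
  shows "n * x \<le> card {j. j < n \<and> real j / n < x}"
proof -
  have "{..<nat \<lceil>n * x\<rceil>} \<subseteq> {j. j < n \<and> real j / n < x}"
  proof
    fix j assume "j \<in> {..<nat \<lceil>n * x\<rceil>}"
    then have "int j < \<lceil>n * x\<rceil>" by auto
    then have j: "real j < n * x" by (simp add: less_ceiling_iff)
    also have "\<dots> \<le> real n * 1" using assms by (intro mult_left_mono) auto
    finally show "j \<in> {j. j < n \<and> real j / n < x}" using j assms by (auto simp: field_simps)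
  qed
  then have "card {..<nat \<lceil>n * x\<rceil>} \<le> card {j. j < n \<and> real j / n < x}" by (intro card_mono) auto
  then have "real (nat \<lceil>n * x\<rceil>) \<le> card {j. j < n \<and> real j / n < x}" by simp
  then show ?thesis using of_nat_ceiling[of "n * x"] by linarith
qed

text \<open>A mechanism is compared with the uniform lottery over the \<open>n\<close> prices at which the allocation
  first exceeds \<open>j / n\<close>; up to an error of \<open>v / n\<close> it is pointwise no better.\<close>

locale mechanism =
  fixes S :: "real set" and x t :: "real \<Rightarrow> real"
  assumes S_nonneg: "\<And>v. v \<in> S \<Longrightarrow> 0 \<le> v"
    and alloc: "\<And>v. v \<in> S \<Longrightarrow> 0 \<le> x v" "\<And>v. v \<in> S \<Longrightarrow> x v \<le> 1"
    and IC: "\<And>v w. v \<in> S \<Longrightarrow> w \<in> S \<Longrightarrow> v * x w - t w \<le> v * x v - t v"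
    and IR: "\<And>v. v \<in> S \<Longrightarrow> 0 \<le> v * x v - t v"
begin

definition above :: "real \<Rightarrow> real set" where "above \<theta> = {v \<in> S. \<theta> < x v}"
definition thr :: "real \<Rightarrow> real" where "thr \<theta> = Inf (above \<theta>)"

lemma thr_le: "v \<in> above \<theta> \<Longrightarrow> thr \<theta> \<le> v"
  unfolding thr_def using S_nonneg by (intro cInf_lower bdd_belowI[of _ 0]) (auto simp: above_def)

lemma thr_approx:
  assumes "above \<theta> \<noteq> {}" "thr \<theta> < v" shows "\<exists>w\<in>above \<theta>. w < v"
  using cInf_lessD[of "above \<theta>" v] assms by (auto simp: thr_def)

lemma thr_nonneg: "above \<theta> \<noteq> {} \<Longrightarrow> 0 \<le> thr \<theta>"
  unfolding thr_def using S_nonneg by (intro cInf_greatest) (auto simp: above_def)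

lemma util_step:
  assumes "v \<in> S" "w \<in> S" shows "(v - w) * x w + (w * x w - t w) \<le> v * x v - t v"
  using IC[OF assms] by (simp add: algebra_simps)

text \<open>A discrete envelope formula, by induction on the number of grid levels: once the
  allocation exceeds \<open>Suc k / n\<close>, utility grows with slope at least
  \<open>Suc k / n\<close>, while each of at most \<open>Suc k\<close> summands grows with slope at
  most \<open>1 / n\<close>.\<close>

lemma util_lower:
  fixes n :: nat
  assumes "0 < n" "v \<in> S"
  shows "(\<Sum>j\<in>{j\<in>{1..k}. above (real j / n) \<noteq> {}}. max 0 (v - thr (real j / n))) / n \<le> v * x v - t v"
  using assms(2)
proof (induction k arbitrary: v)
  case 0
  then show ?case using IR by simp
next
  case (Suc k)
  let ?J = "\<lambda>k. {j\<in>{1..k}. above (real j / n) \<noteq> {}}"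
  let ?f = "\<lambda>v j. max 0 (v - thr (real j / n))"
  let ?\<theta> = "real (Suc k) / n"
  show ?case
  proof (cases "above ?\<theta> \<noteq> {} \<and> thr ?\<theta> < v")
    case False
    have "sum (?f v) (?J (Suc k)) \<le> sum (?f v) (?J k)"
    proof (cases "above ?\<theta> = {}")
      case True
      then have "?J (Suc k) = ?J k" by (auto simp: le_Suc_eq)
      then show ?thesis by simp
    next
      case nonempty: False
      then have "?J (Suc k) = insert (Suc k) (?J k)" by (auto simp: le_Suc_eq)
      moreover have "?f v (Suc k) = 0" using False nonempty by simp
      ultimately show ?thesis by simp
    qed
    then have "sum (?f v) (?J (Suc k)) / n \<le> sum (?f v) (?J k) / n" by (intro divide_right_mono) auto
    also have "\<dots> \<le> v * x v - t v" using Suc by blast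
    finally show ?thesis .
  next
    case True
    have J: "?J (Suc k) = insert (Suc k) (?J k)" using True by (auto simp: le_Suc_eq)
    \<comment> \<open>The induction hypothesis is used at \<open>w\<close>, where the allocation
      exceeds the new level; the incentive constraint then carries the bound from \<open>w\<close>
      to \<open>v\<close>.\<close>
    have step: "sum (?f v) (?J k) / n + (v - w) / n \<le> v * x v - t v" if w: "w \<in> above ?\<theta>" "w < v" for w
    proof -
      have "sum (?f v) (?J k) \<le> (\<Sum>j\<in>?J k. ?f w j + (v - w))"
        using w by (intro sum_mono) auto
      also have "\<dots> = sum (?f w) (?J k) + card (?J k) * (v - w)" by (simp add: sum.distrib)
      also have "card (?J k) * (v - w) \<le> k * (v - w)"
      proof (intro mult_right_mono)
        have "card (?J k) \<le> card {1..k}" by (intro card_mono) auto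
        then show "real (card (?J k)) \<le> real k" by simp
      qed (use w in auto)
      finally have "sum (?f v) (?J k) / n + (v - w) / n
          \<le> (sum (?f w) (?J k) + k * (v - w)) / n + (v - w) / n"
        by (intro add_right_mono divide_right_mono) auto
      also have "\<dots> = sum (?f w) (?J k) / n + (v - w) * ?\<theta>"
        by (simp add: add_divide_distrib diff_divide_distrib algebra_simps)
      also have "\<dots> \<le> (w * x w - t w) + (v - w) * x w"
        using w Suc.IH[of w] by (intro add_mono mult_left_mono) (auto simp: above_def)
      also have "\<dots> \<le> v * x v - t v"
        using util_step[of v w] w Suc.prems by (simp add: above_def)
      finally show ?thesis .
    qed
    \<comment> \<open>The infimum \<open>thr\<close> need not belong to \<open>above\<close>, so
      \<open>w\<close> only approaches it from above.\<close>
    have "sum (?f v) (?J k) / n + (v - thr ?\<theta>) / n \<le> v * x v - t v"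
    proof (rule field_le_epsilon)
      fix e :: real assume e: "e > 0"
      obtain w where w: "w \<in> above ?\<theta>" "w < min v (thr ?\<theta> + e)"
        using thr_approx[of ?\<theta> "min v (thr ?\<theta> + e)"] True e by auto
      have "(v - thr ?\<theta>) / n \<le> (v - w + e) / n" using w by (intro divide_right_mono) auto
      also have "\<dots> = (v - w) / n + e / n" by (simp add: add_divide_distrib)
      also have "e / n \<le> e / 1" using e assms by (intro divide_left_mono) auto
      finally show "sum (?f v) (?J k) / n + (v - thr ?\<theta>) / n \<le> v * x v - t v + e"
        using step[of w] w by simp
    qed
    then show ?thesis using J True by (simp add: add_divide_distrib)
  qed
qed

text \<open>The objective equals \<open>v * x v\<close> minus \<open>1 - \<mu>\<close> times the
  utility. The allocation is bounded above by the grid count and the utility below by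
  \<open>util_lower\<close>; both estimates point the same way because
  \<open>\<mu> \<le> 1\<close>.\<close>

lemma objective_le_lottery:
  fixes n :: nat
  assumes "0 \<le> \<mu>" "\<mu> \<le> 1" "0 < n" "v \<in> S"
  shows "t v + \<mu> * (v * x v - t v) \<le>
    (\<Sum>j\<in>{j\<in>{..<n}. above (real j / n) \<noteq> {}}.
       thr (real j / n) * indicat_real {thr (real j / n)..} v + \<mu> * max 0 (v - thr (real j / n))) / n + v / n"
proof -
  define J where "J = {j\<in>{..<n}. above (real j / n) \<noteq> {}}"
  define s where "s j = thr (real j / n)" for j
  have fin: "finite J" by (simp add: J_def)
  have s_nonneg: "0 \<le> s j" if "j \<in> J" for j using that thr_nonneg by (auto simp: J_def s_def)
  have v: "0 \<le> v" using S_nonneg assms by auto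
  have "{j. j < n \<and> real j / n < x v} \<subseteq> {j\<in>J. s j \<le> v}"
    using assms thr_le by (auto simp: J_def s_def above_def)
  then have "card {j. j < n \<and> real j / n < x v} \<le> card {j\<in>J. s j \<le> v}"
    using fin by (intro card_mono) auto
  moreover have "n * x v \<le> card {j. j < n \<and> real j / n < x v}"
    using assms alloc by (intro rounded_up_eq_card) auto
  ultimately have "n * x v \<le> card {j\<in>J. s j \<le> v}" by linarith
  also have "real (card {j\<in>J. s j \<le> v}) = (\<Sum>j\<in>J. indicat_real {s j..} v)"
    using fin by (simp add: indicator_def sum.If_cases Int_def)
  finally have x: "n * x v \<le> (\<Sum>j\<in>J. indicat_real {s j..} v)" .
  \<comment> \<open>\<open>util_lower\<close> starts at \<open>j = 1\<close>. The omitted price of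
    index 0 yields surplus at most \<open>v\<close>, which is the source of the error
    \<open>v / n\<close>.\<close>
  have "(\<Sum>j\<in>J. max 0 (v - s j)) \<le> v + (\<Sum>j\<in>J - {0}. max 0 (v - s j))"
    using fin v s_nonneg[of 0] by (cases "0 \<in> J") (auto simp: sum.remove)
  also have "J - {0} = {j\<in>{1..n-1}. above (real j / n) \<noteq> {}}" by (auto simp: J_def)
  also have "(\<Sum>j\<in>\<dots>. max 0 (v - s j)) \<le> n * (v * x v - t v)"
    using util_lower[of n v "n - 1"] assms by (simp add: s_def field_simps)
  finally have u: "(\<Sum>j\<in>J. max 0 (v - s j)) \<le> v + n * (v * x v - t v)" by simp
  have "n * (t v + \<mu> * (v * x v - t v)) = v * (n * x v) - (1 - \<mu>) * (n * (v * x v - t v))"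
    by (simp add: algebra_simps)
  also have "\<dots> \<le> v * (\<Sum>j\<in>J. indicat_real {s j..} v) - (1 - \<mu>) * ((\<Sum>j\<in>J. max 0 (v - s j)) - v)"
    using x u v assms by (intro diff_mono mult_left_mono) auto
  also have "\<dots> = (\<Sum>j\<in>J. v * indicat_real {s j..} v - (1 - \<mu>) * max 0 (v - s j)) + (1 - \<mu>) * v"
    by (simp add: sum_subtractf sum_distrib_left sum.distrib algebra_simps)
  also have "(\<Sum>j\<in>J. v * indicat_real {s j..} v - (1 - \<mu>) * max 0 (v - s j))
     = (\<Sum>j\<in>J. s j * indicat_real {s j..} v + \<mu> * max 0 (v - s j))"
    by (intro sum.cong) (auto simp: indicator_def max_def algebra_simps)
  also have "(1 - \<mu>) * v \<le> v" using assms v by (simp add: mult_left_le_one_le)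
  finally have "n * (t v + \<mu> * (v * x v - t v)) \<le>
    (\<Sum>j\<in>J. s j * indicat_real {s j..} v + \<mu> * max 0 (v - s j)) + v" by simp
  then have "t v + \<mu> * (v * x v - t v) \<le>
    ((\<Sum>j\<in>J. s j * indicat_real {s j..} v + \<mu> * max 0 (v - s j)) + v) / n"
    using assms by (simp add: field_simps)
  then show ?thesis by (simp add: add_divide_distrib J_def s_def)
qed

end

section \<open>Lagrangian upper bound over all mechanisms\<close>

context valuation begin

text \<open>Averaged over \<open>M\<close>, the lottery estimate is a mean of terms
  \<open>R s + \<mu> * W s\<close>. The error \<open>v / n\<close> need not be integrable when
  \<open>\<mu> = 0\<close>, so values are first truncated at \<open>V\<close>; then \<open>n\<close>
  and afterwards \<open>V\<close> tend to infinity.\<close>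

lemma lagrangian_bound:
  assumes m: "(x, t) \<in> BIC_IR M"
    and lam: "0 \<le> \<mu>" "\<mu> \<le> 1" "\<mu> = 0 \<or> integrable M (\<lambda>v. v)"
    and C: "0 \<le> C" "\<And>s. s \<in> val_set vL vH \<Longrightarrow> R s + \<mu> * W s \<le> C"
  shows "(\<integral>v. t v + \<mu> * (v * x v - t v) \<partial>M) \<le> C"
proof -
  let ?S = "val_set vL vH"
  interpret mechanism ?S x t
    using m val_nonneg unfolding BIC_IR_def supp_eq by unfold_locales auto
  have meas [measurable]: "x \<in> borel_measurable borel" "t \<in> borel_measurable borel"
    and t: "integrable M t" using m by (auto simp: BIC_IR_def)
  define g where "g v = t v + \<mu> * (v * x v - t v)" for v
  define \<phi> where "\<phi> s v = s * indicat_real {s..} v + \<mu> * max 0 (v - s)" for s v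
  have [measurable]: "g \<in> borel_measurable borel" "\<phi> s \<in> borel_measurable borel" for s
    unfolding g_def[abs_def] \<phi>_def[abs_def] by measurable
  have g: "integrable M g"
  proof (cases "\<mu> = 0")
    case True
    then show ?thesis using t by (simp add: g_def[abs_def])
  next
    case False
    then have id: "integrable M (\<lambda>v. v)" using lam by simp
    have "integrable M (\<lambda>v. v * x v)"
    proof (rule Bochner_Integration.integrable_bound[OF id])
      show "AE v in M. norm (v * x v) \<le> norm v"
        using AE_val by (rule eventually_mono) (use alloc in \<open>auto simp: abs_mult mult_left_le\<close>)
    qed simp
    then show ?thesis unfolding g_def[abs_def] using t by simp
  qed
  have \<phi>_int: "integrable M (\<phi> s)" for s
  proof -
    have "integrable M (\<lambda>v. s * indicat_real {s..} v)"
      by (intro integrable_mult_right integrable_real_indicator) (auto simp: emeasure_eq_measure)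
    moreover have "integrable M (\<lambda>v. \<mu> * max 0 (v - s))" using lam by auto
    ultimately show ?thesis unfolding \<phi>_def[abs_def] by simp
  qed
  have \<phi>_val: "(\<integral>v. \<phi> s v \<partial>M) = R s + \<mu> * W s" for s
  proof -
    have "integrable M (\<lambda>v. s * indicat_real {s..} v)"
      by (intro integrable_mult_right integrable_real_indicator) (auto simp: emeasure_eq_measure)
    moreover have "integrable M (\<lambda>v. \<mu> * max 0 (v - s))" using lam by auto
    ultimately show ?thesis unfolding \<phi>_def by (simp add: R_def G_def W_def)
  qed
  \<comment> \<open>The support is closed, so it contains the infimum and the bound \<open>C\<close>
    applies to the thresholds.\<close>
  have thr_mem: "thr \<theta> \<in> ?S" if "above \<theta> \<noteq> {}" for \<theta>
    using that val_set_closed unfolding thr_def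
    by (intro closed_subset_contains_Inf bdd_belowI[of _ 0]) (auto simp: above_def S_nonneg)
  have trunc: "(\<integral>v. indicat_real {..real V} v * g v \<partial>M) \<le> C + V / n" if n: "0 < n" for V n :: nat
  proof -
    define J where "J = {j\<in>{..<n}. above (real j / n) \<noteq> {}}"
    have J: "finite J" "card J \<le> n"
      using card_mono[of "{..<n}" J] by (auto simp: J_def)
    have "(\<integral>v. indicat_real {..real V} v * g v \<partial>M) \<le> (\<integral>v. (\<Sum>j\<in>J. \<phi> (thr (real j / n)) v) / n + V / n \<partial>M)"
    proof (rule integral_mono_AE)
      show "integrable M (\<lambda>v. indicat_real {..real V} v * g v)"
        using g by (rule Bochner_Integration.integrable_bound) (auto simp: indicator_def)
      show "integrable M (\<lambda>v. (\<Sum>j\<in>J. \<phi> (thr (real j / n)) v) / n + V / n)"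
        using \<phi>_int by simp
      show "AE v in M. indicat_real {..real V} v * g v \<le> (\<Sum>j\<in>J. \<phi> (thr (real j / n)) v) / n + V / n"
        using AE_val
      proof (rule eventually_mono)
        fix v assume v: "v \<in> ?S"
        have nn: "0 \<le> (\<Sum>j\<in>J. \<phi> (thr (real j / n)) v)"
          using thr_nonneg lam by (intro sum_nonneg) (auto simp: \<phi>_def J_def)
        show "indicat_real {..real V} v * g v \<le> (\<Sum>j\<in>J. \<phi> (thr (real j / n)) v) / n + V / n"
        proof (cases "v \<le> V")
          case True
          have "g v \<le> (\<Sum>j\<in>J. \<phi> (thr (real j / n)) v) / n + v / n"
            unfolding g_def J_def \<phi>_def by (rule objective_le_lottery[OF lam(1,2) n v])
          also have "v / n \<le> V / n" using True by (intro divide_right_mono) auto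
          finally show ?thesis using True by simp
        qed (use nn in simp)
      qed
    qed
    also have "\<dots> = (\<Sum>j\<in>J. R (thr (real j / n)) + \<mu> * W (thr (real j / n))) / n + V / n"
      using \<phi>_int prob_space by (simp add: \<phi>_val)
    also have "\<dots> \<le> (\<Sum>j\<in>J. C) / n + V / n"
      using C thr_mem by (intro add_right_mono divide_right_mono sum_mono) (auto simp: J_def)
    \<comment> \<open>\<open>J\<close> can have fewer than \<open>n\<close> elements; the missing
      lottery outcomes stand for no sale, with value \<open>0 \<le> C\<close>.\<close>
    also have "(\<Sum>j\<in>J. C) / n \<le> C"
    proof -
      have "card J * C \<le> n * C" using J C by (intro mult_right_mono) auto
      then show ?thesis using n by (simp add: field_simps)
    qed
    finally show ?thesis by simp
  qed
  have "(\<integral>v. indicat_real {..real V} v * g v \<partial>M) \<le> C" for V :: nat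
  proof (rule tendsto_lowerbound)
    have "(\<lambda>n. C + real V / real n) \<longlonglongrightarrow> C + 0"
      by (intro tendsto_intros lim_const_over_n)
    then show "(\<lambda>n. C + real V / real n) \<longlonglongrightarrow> C" by simp
    show "\<forall>\<^sub>F n in sequentially. (\<integral>v. indicat_real {..real V} v * g v \<partial>M) \<le> C + real V / real n"
      using eventually_gt_at_top[of 0] by (rule eventually_mono) (rule trunc)
  qed simp
  moreover have "(\<lambda>V::nat. \<integral>v. indicat_real {..real V} v * g v \<partial>M) \<longlonglongrightarrow> (\<integral>v. g v \<partial>M)"
  proof (rule integral_dominated_convergence[where w="\<lambda>v. \<bar>g v\<bar>"])
    show "AE v in M. (\<lambda>V::nat. indicat_real {..real V} v * g v) \<longlonglongrightarrow> g v"
    proof (rule AE_I2, rule tendsto_eventually)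
      fix v
      show "\<forall>\<^sub>F V in sequentially. indicat_real {..real V} v * g v = g v"
        using eventually_ge_at_top[of "nat \<lceil>v\<rceil>"]
      proof (rule eventually_mono)
        fix V assume "nat \<lceil>v\<rceil> \<le> V"
        then have "v \<le> real V" by linarith
        then show "indicat_real {..real V} v * g v = g v" by simp
      qed
    qed
  qed (use g in \<open>auto simp: indicator_def\<close>)
  ultimately have "(\<integral>v. g v \<partial>M) \<le> C"
    by (intro tendsto_upperbound[of _ _ sequentially]) auto
  then show ?thesis by (simp add: g_def)
qed

section \<open>Revenue ratio at a fixed surplus level\<close>

definition posted_revenues :: "real \<Rightarrow> real set" where
  "posted_revenues U = {revenue M m |m. m \<in> price_posting M \<and> ennreal U \<le> buyer_util M m}"
definition feasible_revenues :: "real \<Rightarrow> real set" where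
  "feasible_revenues U = {revenue M m |m. m \<in> BIC_IR M \<and> ennreal U \<le> buyer_util M m}"

lemma posted_revenues_eq:
  "posted_revenues U = {R p |p. ennreal U \<le> buyer_util M (posted_price p)}"
proof -
  have "\<exists>p. r = R p \<and> ennreal U \<le> buyer_util M (posted_price p)" if "r \<in> posted_revenues U" for r
    using that by (auto simp: posted_revenues_def price_posting_def posted_revenue)
  moreover have "R p \<in> posted_revenues U" if "ennreal U \<le> buyer_util M (posted_price p)" for p
    unfolding posted_revenues_def price_posting_def using that posted_BIC posted_revenue[symmetric] by blast
  ultimately show ?thesis by blast
qed

lemma posted_subset: "posted_revenues U \<subseteq> feasible_revenues U"
  by (auto simp: posted_revenues_def feasible_revenues_def price_posting_def)

lemma feasible_le:
  assumes C: "0 \<le> C" "\<And>s. s \<in> val_set vL vH \<Longrightarrow> R s \<le> C" and "r \<in> feasible_revenues U"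
  shows "r \<le> C"
proof -
  obtain x t where "(x, t) \<in> BIC_IR M" "r = revenue M (x, t)"
    using assms(3) unfolding feasible_revenues_def by force
  then show ?thesis using lagrangian_bound[of x t 0 C] C by (simp add: revenue_def)
qed

text \<open>Weak duality: a feasible mechanism has surplus at least \<open>U\<close>, so adding
  \<open>\<mu>\<close> times the excess over \<open>U\<close> cannot lower its value.\<close>

lemma feasible_le_lagrangian:
  assumes id: "integrable M (\<lambda>v. v)" and lam: "0 \<le> \<mu>" "\<mu> \<le> 1" and U: "0 \<le> U" "0 \<le> C"
    and C: "\<And>s. s \<in> val_set vL vH \<Longrightarrow> R s + \<mu> * (W s - U) \<le> C"
    and r: "r \<in> feasible_revenues U"
  shows "r \<le> C"
proof -
  obtain x t where m: "(x, t) \<in> BIC_IR M" "r = revenue M (x, t)" "ennreal U \<le> buyer_util M (x, t)"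
    using r unfolding feasible_revenues_def by force
  have [measurable]: "x \<in> borel_measurable borel" "t \<in> borel_measurable borel"
    and t: "integrable M t" using m by (auto simp: BIC_IR_def)
  have x: "AE v in M. 0 \<le> x v \<and> x v \<le> 1 \<and> 0 \<le> v \<and> 0 \<le> v * x v - t v"
    using AE_val by (rule eventually_mono) (use m val_nonneg in \<open>auto simp: BIC_IR_def supp_eq\<close>)
  have vx: "integrable M (\<lambda>v. v * x v)"
  proof (rule Bochner_Integration.integrable_bound[OF id])
    show "AE v in M. norm (v * x v) \<le> norm v"
      using x by (rule eventually_mono) (auto simp: abs_mult mult_left_le)
  qed simp
  have "buyer_util M (x, t) = ennreal (\<integral>v. v * x v - t v \<partial>M)"
    unfolding buyer_util_def fst_conv snd_conv
    using vx t by (intro nn_integral_eq_integral eventually_mono[OF x]) auto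
  then have "U \<le> (\<integral>v. v * x v - t v \<partial>M)"
    using m(3) U integral_nonneg_AE[OF eventually_mono[OF x, of "\<lambda>v. 0 \<le> v * x v - t v"]]
    by simp
  then have "\<mu> * U \<le> \<mu> * (\<integral>v. v * x v - t v \<partial>M)" using lam by (intro mult_left_mono)
  moreover have "(\<integral>v. t v + \<mu> * (v * x v - t v) \<partial>M) \<le> C + \<mu> * U"
    using m(1) lam id U C by (intro lagrangian_bound) (auto simp: algebra_simps)
  moreover have "(\<integral>v. t v + \<mu> * (v * x v - t v) \<partial>M) = (\<integral>v. t v \<partial>M) + \<mu> * (\<integral>v. v * x v - t v \<partial>M)"
    using vx t by simp
  ultimately show ?thesis using m(2) by (simp add: revenue_def)
qed

lemma feasible_bdd: "bdd_above (feasible_revenues U)"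
proof -
  obtain C where C: "\<And>s. R s \<le> C" using R_bounded by blast
  have "0 \<le> C" using C[of 0] by (simp add: R_def)
  then show ?thesis using feasible_le[of C] C by (auto intro!: bdd_aboveI[of _ C])
qed

lemma posted_bdd: "bdd_above (posted_revenues U)"
  by (rule bdd_above_mono[OF feasible_bdd posted_subset])

lemma posted_positive:
  assumes "achievable M U" shows "\<exists>r\<in>posted_revenues U. 0 < r"
proof -
  have "\<exists>p>0. ereal p < vH \<and> ennreal U \<le> buyer_util M (posted_price p)"
  proof (cases "integrable M (\<lambda>v. v)")
    case True
    have U: "0 \<le> U" "U < (\<integral>v. v \<partial>M)"
      using assms unfolding achievable_def mean_finite[OF True]
      by (auto simp: ennreal_less_iff)
    \<comment> \<open>A level strictly between \<open>U\<close> and the mean is positive even if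
      \<open>U = 0\<close>, as \<open>W_level\<close> requires.\<close>
    define U' where "U' = (U + (\<integral>v. v \<partial>M)) / 2"
    obtain p where "0 < p" "ereal p < vH" "W p = U'"
      using W_level[OF True, of U'] U by (auto simp: U'_def)
    then show ?thesis using U by (intro exI[of _ p]) (auto simp: posted_util_finite[OF True] U'_def intro!: ennreal_leI)
  next
    case False
    obtain p where "ereal vL < ereal p" "ereal p < vH" using ereal_dense2 vL_less by blast
    then show ?thesis using False vL_nonneg by (intro exI[of _ p]) (auto simp: posted_util_infinite)
  qed
  then obtain p where "0 < p" "ereal p < vH" "ennreal U \<le> buyer_util M (posted_price p)" by blast
  moreover from this have "0 < R p" using G_pos[of p] by (simp add: R_def)
  ultimately show ?thesis unfolding posted_revenues_eq by blast
qed

definition ratio :: "real \<Rightarrow> real" where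
  "ratio U = Sup (posted_revenues U) / Sup (feasible_revenues U)"

lemma Sup_positive:
  assumes "achievable M U"
  shows "0 < Sup (posted_revenues U)" "Sup (posted_revenues U) \<le> Sup (feasible_revenues U)"
proof -
  obtain r where "r \<in> posted_revenues U" "0 < r" using posted_positive[OF assms] by blast
  then show "0 < Sup (posted_revenues U)" using posted_bdd cSup_upper by (meson less_le_trans)
  show "Sup (posted_revenues U) \<le> Sup (feasible_revenues U)"
    using \<open>r \<in> posted_revenues U\<close> posted_subset feasible_bdd by (intro cSup_subset_mono) auto
qed

lemma ratio_bounds: assumes "achievable M U" shows "0 \<le> ratio U" "ratio U \<le> 1"
  using Sup_positive[OF assms] by (auto simp: ratio_def)

text \<open>With a finite mean and \<open>U > 0\<close>, the price \<open>p\<close> with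
  \<open>W p = U\<close> exists and all prices up to \<open>p\<close> are feasible, so
  \<open>N\<close> can be taken as the best posted revenue. Otherwise every price meets the
  constraint and multiplier 0 suffices.\<close>

lemma ratio_ge:
  assumes U: "achievable M U" and c: "1 \<le> c"
    and lagr: "\<And>p N. integrable M (\<lambda>v. v) \<Longrightarrow> 0 < p \<Longrightarrow> ereal p < vH \<Longrightarrow> 0 < N \<Longrightarrow> (\<And>s. s \<le> p \<Longrightarrow> R s \<le> N) \<Longrightarrow>
       \<exists>\<mu>\<in>{0..1}. \<forall>s. vL \<le> s \<longrightarrow> ereal s < vH \<longrightarrow> R s + \<mu> * (W s - W p) \<le> c * N"
  shows "1 / c \<le> ratio U"
proof -
  let ?N = "Sup (posted_revenues U)"
  have N: "0 < ?N" using Sup_positive[OF U] by simp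
  have le_N: "R p \<le> ?N" if "ennreal U \<le> buyer_util M (posted_price p)" for p
    using that posted_bdd by (intro cSup_upper) (auto simp: posted_revenues_eq)
  have N_le: "?N \<le> c * ?N" using mult_right_mono[OF c, of ?N] N by simp
  have "r \<le> c * ?N" if r: "r \<in> feasible_revenues U" for r
  proof (cases "integrable M (\<lambda>v. v) \<and> 0 < U")
    case False
    have "ennreal U \<le> buyer_util M (posted_price p)" for p
    proof (cases "integrable M (\<lambda>v. v)")
      case True
      then show ?thesis using False by (simp add: ennreal_neg)
    qed (simp add: posted_util_infinite)
    then have "R p \<le> ?N" for p using le_N by blast
    then have "r \<le> ?N" using feasible_le[of ?N r U] r N by auto
    then show ?thesis using N_le by linarith
  next
    case True
    then have id: "integrable M (\<lambda>v. v)" and U0: "0 < U" by auto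
    have "U < (\<integral>v. v \<partial>M)"
      using U unfolding achievable_def mean_finite[OF id] by (auto simp: ennreal_less_iff)
    then obtain p where p: "0 < p" "ereal p < vH" "W p = U" using W_level id U0 by blast
    have "R s \<le> ?N" if "s \<le> p" for s
    proof (rule le_N)
      show "ennreal U \<le> buyer_util M (posted_price s)"
        using W_antimono[OF id that] p by (auto simp: posted_util_finite[OF id] intro!: ennreal_leI)
    qed
    then obtain \<mu> where mu: "0 \<le> \<mu>" "\<mu> \<le> 1"
      and *: "\<And>s. vL \<le> s \<Longrightarrow> ereal s < vH \<Longrightarrow> R s + \<mu> * (W s - U) \<le> c * ?N"
      using lagr[OF id p(1,2) N] p(3) by (auto simp: Bex_def)
    show ?thesis
    proof (rule feasible_le_lagrangian[OF id mu _ _ _ r])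
      fix s assume s: "s \<in> val_set vL vH"
      show "R s + \<mu> * (W s - U) \<le> c * ?N"
      proof (cases "ereal s < vH")
        case True
        then show ?thesis using * s by (auto simp: val_set_def)
      next
        case False
        then have sH: "vH = ereal s" using s by (auto simp: val_set_def)
        \<comment> \<open>The multiplier bound covers prices below \<open>vH\<close>; the top price
          is reached as a limit, using that \<open>W\<close> is antitone.\<close>
        have "s * G s \<le> c * ?N - \<mu> * (W s - U)"
        proof (rule R_mono_limit)
          show "vL < s" using sH vL_less by simp
          fix x assume x: "vL < x" "x < s"
          have "x * G s \<le> R x" unfolding R_def using x vL_nonneg by (intro mult_left_mono G_antimono) auto
          moreover have "\<mu> * (W s - U) \<le> \<mu> * (W x - U)"
            using mu x W_antimono[OF id, of x s] by (intro mult_left_mono) auto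
          ultimately show "x * G s \<le> c * ?N - \<mu> * (W s - U)" using *[of x] x sH by simp
        qed
        then show ?thesis by (simp add: R_def)
      qed
    qed (use U0 N c in auto)
  qed
  moreover have "feasible_revenues U \<noteq> {}" using posted_positive[OF U] posted_subset by blast
  ultimately have "Sup (feasible_revenues U) \<le> c * ?N" by (intro cSup_least)
  moreover have "0 < Sup (feasible_revenues U)" using Sup_positive[OF U] by linarith
  ultimately show ?thesis using c by (simp add: ratio_def field_simps)
qed

text \<open>The lottery between the two prices meets the surplus level of the price \<open>p\<close> in between.\<close>

lemma ratio_le_lottery:
  assumes id: "integrable M (\<lambda>v. v)" and p: "p\<^sub>1 < p" "p < p\<^sub>2" "ereal p < vH" "0 < W p" "0 < p"
    and N: "\<And>s. s \<le> p \<Longrightarrow> R s \<le> N"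
    and A: "A = W p\<^sub>1 - W p" and B: "B = W p - W p\<^sub>2" "0 < A" "0 \<le> B"
    and mix: "0 < A * R p\<^sub>2 + B * R p\<^sub>1"
  shows "achievable M (W p)" "ratio (W p) \<le> N * (A + B) / (A * R p\<^sub>2 + B * R p\<^sub>1)"
proof -
  have "W p < W 0" using W_strict id p by blast
  then show ach: "achievable M (W p)"
    using W_nonneg p vL_nonneg by (simp add: achievable_def mean_finite[OF id] W_below[OF id] ennreal_less_iff)
  \<comment> \<open>This weight on the lower price makes the average surplus of the two prices equal
    \<open>W p\<close>.\<close>
  define \<alpha> where "\<alpha> = B / (A + B)"
  have \<alpha>: "0 \<le> \<alpha>" "\<alpha> \<le> 1" "1 - \<alpha> = A / (A + B)" using B by (auto simp: \<alpha>_def field_simps)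
  define x where "x v = \<alpha> * fst (posted_price p\<^sub>1) v + (1 - \<alpha>) * fst (posted_price p\<^sub>2) v" for v
  define t where "t v = \<alpha> * snd (posted_price p\<^sub>1) v + (1 - \<alpha>) * snd (posted_price p\<^sub>2) v" for v
  have P: "posted_price q \<in> BIC_IR M" for q by (rule posted_BIC)
  have u: "v * x w - t w = \<alpha> * (v * fst (posted_price p\<^sub>1) w - snd (posted_price p\<^sub>1) w)
      + (1 - \<alpha>) * (v * fst (posted_price p\<^sub>2) w - snd (posted_price p\<^sub>2) w)" for v w
    by (simp add: x_def t_def algebra_simps)
  have post: "fst (posted_price q) \<in> borel_measurable borel" "snd (posted_price q) \<in> borel_measurable borel"
     "integrable M (snd (posted_price q))" for q
    using P[of q] by (auto simp: BIC_IR_def)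
  have mech: "(x, t) \<in> BIC_IR M"
    unfolding BIC_IR_def
  proof (intro CollectI case_prodI conjI ballI)
    show "x \<in> borel_measurable borel" "t \<in> borel_measurable borel"
      unfolding x_def[abs_def] t_def[abs_def] using post by measurable
    show "integrable M t" unfolding t_def[abs_def] using post by simp
    fix v assume v: "v \<in> supp M"
    show "0 \<le> x v" using \<alpha> by (simp add: x_def posted_price_def)
    have "x v \<le> \<alpha> * 1 + (1 - \<alpha>) * 1" unfolding x_def
      using \<alpha> by (intro add_mono mult_left_mono) (auto simp: posted_price_def)
    then show "x v \<le> 1" by simp
    show "0 \<le> v * x v - t v" unfolding u
      using \<alpha> by (intro add_nonneg_nonneg mult_nonneg_nonneg) (auto simp: posted_price_def)
    fix w assume w: "w \<in> supp M"
    show "v * x w - t w \<le> v * x v - t v"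
      unfolding u using \<alpha> by (intro add_mono mult_left_mono) (auto simp: posted_price_def)
  qed
  have "snd (x, t) = (\<lambda>v. \<alpha> * snd (posted_price p\<^sub>1) v + (1 - \<alpha>) * snd (posted_price p\<^sub>2) v)"
    by (auto simp: t_def)
  then have rev: "revenue M (x, t) = \<alpha> * R p\<^sub>1 + (1 - \<alpha>) * R p\<^sub>2"
    unfolding revenue_def using post by (simp add: posted_revenue[symmetric] revenue_def)
  have "buyer_util M (x, t) = (\<integral>\<^sup>+v. ennreal (\<alpha> * max 0 (v - p\<^sub>1) + (1 - \<alpha>) * max 0 (v - p\<^sub>2)) \<partial>M)"
    unfolding buyer_util_def fst_conv snd_conv u
    by (intro nn_integral_cong arg_cong[where f=ennreal]) (auto simp: posted_price_def max_def)
  also have "\<dots> = ennreal (\<integral>v. \<alpha> * max 0 (v - p\<^sub>1) + (1 - \<alpha>) * max 0 (v - p\<^sub>2) \<partial>M)"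
    using \<alpha>(1,2) id by (intro nn_integral_eq_integral AE_I2) simp_all
  also have "(\<integral>v. \<alpha> * max 0 (v - p\<^sub>1) + (1 - \<alpha>) * max 0 (v - p\<^sub>2) \<partial>M) = \<alpha> * W p\<^sub>1 + (1 - \<alpha>) * W p\<^sub>2"
    using id by (simp add: W_def)
  also have "\<dots> = W p"
  proof -
    have "(A + B) * (\<alpha> * W p\<^sub>1 + (1 - \<alpha>) * W p\<^sub>2) = (A + B) * \<alpha> * W p\<^sub>1 + (A + B) * (1 - \<alpha>) * W p\<^sub>2"
      by (simp only: distrib_left mult.assoc)
    also have "\<dots> = B * W p\<^sub>1 + A * W p\<^sub>2"
      unfolding \<alpha>(3) using B by (simp add: \<alpha>_def)
    also have "\<dots> = (A + B) * W p" by (simp add: A B(1) algebra_simps)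
    finally show ?thesis using B by simp
  qed
  finally have "ennreal (W p) \<le> buyer_util M (x, t)" by simp
  with mech have "revenue M (x, t) \<in> feasible_revenues (W p)"
    unfolding feasible_revenues_def by blast
  then have "\<alpha> * R p\<^sub>1 + (1 - \<alpha>) * R p\<^sub>2 \<le> Sup (feasible_revenues (W p))"
    using feasible_bdd rev by (auto intro!: cSup_upper)
  moreover have "\<alpha> * R p\<^sub>1 + (1 - \<alpha>) * R p\<^sub>2 = (A * R p\<^sub>2 + B * R p\<^sub>1) / (A + B)"
    unfolding \<alpha>(3) by (simp add: \<alpha>_def add_divide_distrib)
  ultimately have D: "(A * R p\<^sub>2 + B * R p\<^sub>1) / (A + B) \<le> Sup (feasible_revenues (W p))" by simp
  have "Sup (posted_revenues (W p)) \<le> N"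
  proof (rule cSup_least)
    show "posted_revenues (W p) \<noteq> {}" using posted_positive[OF ach] by blast
    fix r assume "r \<in> posted_revenues (W p)"
    then obtain s where s: "r = R s" "W p \<le> W s"
      unfolding posted_revenues_eq posted_util_finite[OF id] using W_nonneg by auto
    have "s \<le> p"
    proof (rule ccontr)
      assume "\<not> s \<le> p"
      \<comment> \<open>\<open>W\<close> is strictly decreasing below \<open>vH\<close>, so a point
        below both \<open>s\<close> and \<open>vH\<close> separates the two surplus levels.\<close>
      then obtain q where "ereal p < ereal q" "ereal q < min (ereal s) vH"
        using ereal_dense2[of "ereal p" "min (ereal s) vH"] p by auto
      then have "W q < W p" "W s \<le> W q" using W_strict[OF id] W_antimono[OF id] by auto
      then show False using s by simp
    qed
    then show "r \<le> N" using N s by simp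
  qed
  moreover have "0 < (A * R p\<^sub>2 + B * R p\<^sub>1) / (A + B)" using mix B by simp
  ultimately have "ratio (W p) \<le> N / ((A * R p\<^sub>2 + B * R p\<^sub>1) / (A + B))"
    unfolding ratio_def using D Sup_positive(1)[OF ach] by (intro frac_le) auto
  then show "ratio (W p) \<le> N * (A + B) / (A * R p\<^sub>2 + B * R p\<^sub>1)" by simp
qed

end

section \<open>Regular distributions\<close>

lemma nondecreasing_by_deriv:
  fixes f :: "real \<Rightarrow> real"
  assumes "a \<le> b" "continuous_on {a..b} f"
    and "\<And>x. a < x \<Longrightarrow> x < b \<Longrightarrow> (f has_real_derivative f' x) (at x)"
    and "\<And>x. a < x \<Longrightarrow> x < b \<Longrightarrow> 0 \<le> f' x"
  shows "f a \<le> f b"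
  using assms by (intro DERIV_nonneg_imp_increasing_open[of a b f]) auto

lemma nonincreasing_by_deriv:
  fixes f :: "real \<Rightarrow> real"
  assumes "a \<le> b" "continuous_on {a..b} f"
    and "\<And>x. a < x \<Longrightarrow> x < b \<Longrightarrow> (f has_real_derivative f' x) (at x)"
    and "\<And>x. a < x \<Longrightarrow> x < b \<Longrightarrow> f' x \<le> 0"
  shows "f b \<le> f a"
  using assms by (intro DERIV_nonpos_imp_decreasing_open[of a b f]) auto

context valuation begin

lemma G_cont_on: assumes "ereal b < vH" shows "continuous_on {a..b} G"
proof (intro continuous_at_imp_continuous_on ballI G_cont)
  fix x assume "x \<in> {a..b}"
  then have "ereal x \<le> ereal b" by simp
  then show "ereal x \<noteq> vH" using assms by auto
qed

lemma less_vH: "ereal b < vH \<Longrightarrow> a \<le> b \<Longrightarrow> ereal a < vH"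
  by (meson ereal_less_eq(3) le_less_trans)

definition f :: "real \<Rightarrow> real" where "f = deriv (cdf M)"
definition \<phi> :: "real \<Rightarrow> real" where "\<phi> v = v - G v / f v"

lemma f_nonneg: assumes "vL < x" "ereal x < vH" shows "0 \<le> f x"
proof (rule ccontr)
  assume "\<not> 0 \<le> f x"
  then have "0 < - f x" by simp
  then obtain d where "0 < d" "\<And>h. 0 < h \<Longrightarrow> h < d \<Longrightarrow> G x < G (x + h)"
    using DERIV_pos_inc_right[OF G_deriv[OF assms]] by (auto simp: f_def)
  then have "G x < G (x + d / 2)" by simp
  moreover have "G (x + d / 2) \<le> G x" using \<open>0 < d\<close> by (intro G_antimono) simp
  ultimately show False by simp
qed

text \<open>Where \<open>f\<close> vanishes, \<open>\<phi> v\<close> is \<open>v\<close> by the convention \<open>x / 0 = 0\<close>, so regularity alone has to exclude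
  zeros of the density.  Just above such a point \<open>p\<close> regularity gives \<open>G \<le> (s - p) f\<close>, which contradicts
  the mean value theorem.\<close>

lemma regular_f_pos:
  assumes reg: "mono_on {x. vL < x \<and> ereal x < vH} \<phi>" and p: "vL < p" "ereal p < vH"
  shows "0 < f p"
proof (rule ccontr)
  assume "\<not> 0 < f p"
  then have "f p = 0" using f_nonneg[OF p] by simp
  then have \<phi>p: "\<phi> p = p" by (simp add: \<phi>_def)
  have Gp: "0 < G p" using p G_pos by simp
  have "(G \<longlongrightarrow> G p) (at_right p)"
    using G_cont[of p] p by (auto simp: isCont_def intro: tendsto_mono[OF at_le])
  then have "\<forall>\<^sub>F s in at_right p. G p / 2 < G s" using Gp by (intro order_tendstoD) auto
  then obtain b where b: "p < b" "\<And>s. p < s \<Longrightarrow> s < b \<Longrightarrow> G p / 2 < G s"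
    by (auto simp: eventually_at_right_field)
  obtain s where "ereal p < ereal s" "ereal s < min (ereal b) vH"
    using ereal_dense2[of "ereal p" "min (ereal b) vH"] p b by auto
  then have s: "p < s" "s < b" "ereal s < vH" by auto
  have "\<exists>z>p. z < s \<and> G s - G p = (s - p) * (- f z)"
  proof (rule MVT2[OF s(1)])
    fix x assume "p \<le> x" "x \<le> s"
    then show "(G has_real_derivative - f x) (at x)"
      using p s less_vH unfolding f_def by (intro G_deriv) auto
  qed
  then obtain z where z: "p < z" "z < s" "G p - G s = (s - p) * f z" by (auto simp: algebra_simps)
  have zH: "ereal z < vH" using z s less_vH by auto
  have "G s < G p" using s p by (intro G_strict) auto
  then have fz: "0 < f z" using z s by (metis diff_gt_0_iff_gt zero_less_mult_pos)
  have "\<phi> p \<le> \<phi> z" using reg z p zH by (auto simp: mono_on_def)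
  then have "G z \<le> (z - p) * f z" using fz \<phi>p \<phi>_def[of z] by (simp add: field_simps)
  also have "\<dots> \<le> (s - p) * f z" using z fz by (intro mult_right_mono) auto
  finally have "G z \<le> G p - G s" using z by simp
  moreover have "G s \<le> G z" using z by (intro G_antimono) auto
  ultimately show False using b(2)[OF s(1,2)] by linarith
qed

lemma regular_ratio:
  assumes reg: "mono_on {x. vL < x \<and> ereal x < vH} \<phi>" and U: "achievable M U"
  shows "ratio U = 1"
proof (rule antisym)
  show "ratio U \<le> 1" using ratio_bounds[OF U] by simp
  have "1 / 1 \<le> ratio U"
  proof (rule ratio_ge[OF U])
    fix p N
    assume id: "integrable M (\<lambda>v. v)" and p: "0 < p" "ereal p < vH"
      and N: "0 < N" "\<And>s. s \<le> p \<Longrightarrow> R s \<le> N"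
    show "\<exists>\<mu>\<in>{0..1}. \<forall>s. vL \<le> s \<longrightarrow> ereal s < vH \<longrightarrow> R s + \<mu> * (W s - W p) \<le> 1 * N"
    proof (cases "p \<le> vL")
      case True
      \<comment> \<open>\<open>R + W\<close> is the value realised by trade, which is largest when
        every type buys; there it equals \<open>p + W p\<close>, and
        \<open>p \<le> N\<close>.\<close>
      have "R s + 1 * (W s - W p) \<le> 1 * N" if s: "vL \<le> s" for s
      proof -
        have "W vL - W s \<ge> (s - vL) * G s" using W_diff[OF id s] by simp
        moreover have "W p - W vL = vL - p" using W_below[OF id] True by simp
        moreover have "vL * G s \<le> vL * 1" using vL_nonneg by (intro mult_left_mono) auto
        moreover have "p \<le> N" using N(2)[of p] G_below[OF True] by (simp add: R_def)
        ultimately show ?thesis by (simp add: R_def algebra_simps)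
      qed
      then show ?thesis by (intro bexI[of _ 1]) auto
    next
      case False
      then have pL: "vL < p" by simp
      define \<gamma> where "\<gamma> s = s * f s / G s" for s
      have f_pos: "0 < f s" if "vL < s" "ereal s < vH" for s using regular_f_pos[OF reg] that by blast
      have \<phi>_mono: "\<phi> a \<le> \<phi> b" if "vL < a" "a \<le> b" "ereal b < vH" for a b
        using reg that less_vH by (auto simp: mono_on_def)
      \<comment> \<open>This makes the derivative of \<open>R + \<mu> * W\<close> vanish at
        \<open>p\<close>; the truncation at 0 covers prices at which revenue is no longer
        increasing.\<close>
      define \<mu> where "\<mu> = max 0 (1 - \<gamma> p)"
      have \<gamma>p: "0 \<le> \<gamma> p" using f_pos[OF pL p(2)] p by (simp add: \<gamma>_def)
      have K_deriv: "((\<lambda>s. R s + \<mu> * W s) has_real_derivative G s * ((1 - \<mu>) - \<gamma> s)) (at s)"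
        if "vL < s" "ereal s < vH" for s
      proof -
        have "((\<lambda>s. s * G s + \<mu> * W s) has_real_derivative (1 * G s + (- f s) * s) + \<mu> * (- G s)) (at s)"
          unfolding f_def using that
          by (intro DERIV_add DERIV_mult DERIV_cmult W_deriv id G_deriv DERIV_ident) auto
        moreover have "(1 * G s + (- f s) * s) + \<mu> * (- G s) = G s * ((1 - \<mu>) - \<gamma> s)"
          using G_pos[OF that(2)] by (simp add: \<gamma>_def field_simps)
        ultimately show ?thesis by (simp add: R_def)
      qed
      have K_cont: "continuous_on {a..b} (\<lambda>s. R s + \<mu> * W s)" if "ereal b < vH" for a b
        unfolding R_def using that by (intro continuous_intros G_cont_on W_cont id)
      \<comment> \<open>That is, \<open>\<phi> s = s * (1 - 1 / \<gamma> s)\<close>: the virtual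
        value is negative exactly where \<open>\<gamma> s < 1\<close>.\<close>
      have \<phi>\<gamma>: "\<phi> s * \<gamma> s = s * (\<gamma> s - 1)" "0 < \<gamma> s" if "vL < s" "ereal s < vH" for s
        using f_pos[OF that] G_pos[OF that(2)] that vL_nonneg by (auto simp: \<phi>_def \<gamma>_def field_simps)
      \<comment> \<open>If \<open>\<gamma>\<close> dropped below both 1 and
        \<open>\<gamma> p\<close>, then \<open>1 - 1 / \<gamma>\<close> would be negative and
        smaller than at \<open>p\<close>, and the larger price would amplify it, contradicting
        monotonicity of \<open>\<phi>\<close>. The claim \<open>down\<close> is the mirror
        image.\<close>
      have up: "1 - \<mu> \<le> \<gamma> s" if s: "p \<le> s" "ereal s < vH" for s
      proof (rule ccontr)
        assume "\<not> 1 - \<mu> \<le> \<gamma> s"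
        then have *: "\<gamma> s < 1" "\<gamma> s < \<gamma> p" using \<gamma>p by (auto simp: \<mu>_def)
        have g: "\<phi> s * \<gamma> s = s * (\<gamma> s - 1)" "0 < \<gamma> s" using s pL by (auto intro!: \<phi>\<gamma>)
        have h: "\<phi> p * \<gamma> p = p * (\<gamma> p - 1)" "0 < \<gamma> p" using p pL by (auto intro!: \<phi>\<gamma>)
        have "\<phi> p \<le> \<phi> s" using \<phi>_mono s pL by blast
        then have "\<phi> p * (\<gamma> s * \<gamma> p) \<le> \<phi> s * (\<gamma> s * \<gamma> p)" using g h by (intro mult_right_mono) auto
        then have "(\<phi> p * \<gamma> p) * \<gamma> s \<le> (\<phi> s * \<gamma> s) * \<gamma> p" by (simp only: ac_simps)
        then have "p * (\<gamma> p - 1) * \<gamma> s \<le> s * (\<gamma> s - 1) * \<gamma> p" unfolding g(1) h(1) .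
        moreover have "s * (\<gamma> s - 1) * \<gamma> p \<le> p * (\<gamma> s - 1) * \<gamma> p"
          using s * h by (intro mult_right_mono mult_right_mono_neg) auto
        ultimately have "p * (\<gamma> p - 1) * \<gamma> s \<le> p * (\<gamma> s - 1) * \<gamma> p" by linarith
        then have "p * (\<gamma> p - \<gamma> s) \<le> 0" by (simp add: algebra_simps)
        then show False using * p by (simp add: mult_le_0_iff)
      qed
      have down: "\<gamma> s \<le> \<gamma> p" if s: "vL < s" "s \<le> p" "\<gamma> p < 1" for s
      proof (rule ccontr)
        assume "\<not> \<gamma> s \<le> \<gamma> p"
        then have *: "\<gamma> p < \<gamma> s" by simp
        have g: "\<phi> s * \<gamma> s = s * (\<gamma> s - 1)" "0 < \<gamma> s" using s p less_vH by (auto intro!: \<phi>\<gamma>)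
        have h: "\<phi> p * \<gamma> p = p * (\<gamma> p - 1)" "0 < \<gamma> p" using p pL by (auto intro!: \<phi>\<gamma>)
        have "\<phi> s \<le> \<phi> p" using \<phi>_mono s p by blast
        then have "\<phi> s * (\<gamma> s * \<gamma> p) \<le> \<phi> p * (\<gamma> s * \<gamma> p)" using g h by (intro mult_right_mono) auto
        then have "(\<phi> s * \<gamma> s) * \<gamma> p \<le> (\<phi> p * \<gamma> p) * \<gamma> s" by (simp only: ac_simps)
        then have "s * (\<gamma> s - 1) * \<gamma> p \<le> p * (\<gamma> p - 1) * \<gamma> s" unfolding g(1) h(1) .
        moreover have "p * (\<gamma> p - 1) * \<gamma> s \<le> s * (\<gamma> p - 1) * \<gamma> s"
          using s g by (intro mult_right_mono mult_right_mono_neg) auto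
        ultimately have "s * (\<gamma> s - \<gamma> p) \<le> 0" by (simp add: algebra_simps)
        then show False using * s vL_nonneg by (simp add: mult_le_0_iff)
      qed
      have "R s + \<mu> * W s \<le> N + \<mu> * W p" if s: "vL \<le> s" "ereal s < vH" for s
      proof (cases "p \<le> s")
        case True
        have "R s + \<mu> * W s \<le> R p + \<mu> * W p"
        proof (rule nonincreasing_by_deriv[OF True K_cont[OF s(2)]])
          fix x assume x: "p < x" "x < s"
          then have xH: "ereal x < vH" using s less_vH by auto
          show "((\<lambda>s. R s + \<mu> * W s) has_real_derivative G x * ((1 - \<mu>) - \<gamma> x)) (at x)"
            using x xH pL by (intro K_deriv) auto
          show "G x * ((1 - \<mu>) - \<gamma> x) \<le> 0"
            using up[of x] x xH by (intro mult_nonneg_nonpos) auto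
        qed
        then show ?thesis using N(2)[of p] by simp
      next
        case False
        then have sp: "s \<le> p" by simp
        show ?thesis
        proof (cases "\<gamma> p < 1")
          case True
          have "R s + \<mu> * W s \<le> R p + \<mu> * W p"
          proof (rule nondecreasing_by_deriv[OF sp K_cont[OF p(2)]])
            fix x assume x: "s < x" "x < p"
            then have xH: "ereal x < vH" using p less_vH by auto
            show "((\<lambda>s. R s + \<mu> * W s) has_real_derivative G x * ((1 - \<mu>) - \<gamma> x)) (at x)"
              using x xH s by (intro K_deriv) auto
            show "0 \<le> G x * ((1 - \<mu>) - \<gamma> x)"
              using down[of x] x s True by (intro mult_nonneg_nonneg) (auto simp: \<mu>_def)
          qed
          then show ?thesis using N(2)[of p] by simp
        next
          case False
          then show ?thesis using N(2)[OF sp] by (simp add: \<mu>_def)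
        qed
      qed
      then show ?thesis using \<gamma>p by (intro bexI[of _ \<mu>]) (auto simp: \<mu>_def algebra_simps)
    qed
  qed simp
  then show "1 \<le> ratio U" by simp
qed

end

section \<open>Quasi-regular distributions\<close>

text \<open>The left side is the first diagonal Pade approximant of \<open>ln\<close> at 1; the
  difference has derivative \<open>(w - 1)^2 / (w * (w + 1)^2)\<close>.\<close>

lemma ln_ge_pade:
  fixes w :: real assumes "1 \<le> w" shows "2 * (w - 1) / (w + 1) \<le> ln w"
proof -
  have "ln 1 - 2 * (1 - 1) / (1 + 1) \<le> ln w - 2 * (w - 1) / (w + 1)"
  proof (rule nondecreasing_by_deriv[OF assms])
    show "continuous_on {1..w} (\<lambda>w. ln w - 2 * (w - 1) / (w + 1))"
      by (intro continuous_intros) auto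
    fix x :: real assume "1 < x" "x < w"
    then show "((\<lambda>w. ln w - 2 * (w - 1) / (w + 1)) has_real_derivative 1 / x - 4 / (x + 1)^2) (at x)"
      by (auto intro!: derivative_eq_intros simp: power2_eq_square)
    have "4 * x \<le> (x + 1)^2" using zero_le_power2[of "x - 1"] by (simp add: power2_eq_square algebra_simps)
    then show "0 \<le> 1 / x - 4 / (x + 1)^2" using \<open>1 < x\<close> by (simp add: field_simps)
  qed
  then show ?thesis by simp
qed

lemma cubic_bound:
  fixes w :: real assumes "1 \<le> w"
  defines "k \<equiv> 877 / 4123"
  shows "(1 + k) * w * (w + 1) \<le> (3 * w - 1) * (1 + k * w + (k * w)^2 / 2)"
proof -
  \<comment> \<open>An explicit positivity certificate: \<open>39/10\<close> is close to the
    interior local minimum of the cubic, and the remainder has positive coefficients.\<close>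
  have "(3 * w - 1) * (1 + k * w + (k * w)^2 / 2) - (1 + k) * w * (w + 1) =
      3 / 2 * k^2 * ((w - 1) * (w - 39/10)^2) + 5513/169991290 * w^2 + 44005713/3399825800 * w + 109709827/3399825800"
    unfolding k_def by (simp add: power2_eq_square field_simps)
  moreover have "0 \<le> 3 / 2 * k^2 * ((w - 1) * (w - 39/10)^2)" using assms(1) by simp
  moreover have "0 \<le> w^2" by simp
  ultimately show ?thesis using assms(1) by linarith
qed

text \<open>The value of \<open>k\<close> makes \<open>1 / (1 + k)\<close> exactly
  \<open>0.8246\<close>, and \<open>w\<close> will be \<open>1 / \<mu>\<close>. A quadratic Taylor
  bound for \<open>exp\<close> and the Pade bound for \<open>ln\<close> leave the cubic
  inequality.\<close>

lemma quasi_regular_constant: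
  fixes w :: real assumes w: "1 \<le> w"
  defines "k \<equiv> 877 / 4123"
  shows "(1 + k) * w * exp (- (k * w)) \<le> 1 + ln w"
proof -
  define E where "E = 1 + k * w + (k * w)^2 / 2"
  have E: "0 < E" using w by (auto simp: E_def k_def intro!: add_pos_nonneg)
  have "E \<le> exp (k * w)" unfolding E_def using exp_lower_Taylor_quadratic[of "k * w"] w by (simp add: k_def)
  then have "exp (- (k * w)) \<le> 1 / E" using E by (simp add: exp_minus inverse_eq_divide frac_le)
  then have "(1 + k) * w * exp (- (k * w)) \<le> (1 + k) * w * (1 / E)"
    using w by (intro mult_left_mono) (auto simp: k_def)
  also have "\<dots> \<le> (3 * w - 1) / (w + 1)"
  proof -
    have "(1 + k) * w * (w + 1) \<le> (3 * w - 1) * E"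
      using cubic_bound[OF w] by (simp only: E_def k_def)
    then have "(1 + k) * w \<le> (3 * w - 1) * E / (w + 1)" using w by (simp only: pos_le_divide_eq)
    then have "(1 + k) * w \<le> (3 * w - 1) / (w + 1) * E" by simp
    then show ?thesis using E by (simp add: pos_divide_le_eq)
  qed
  also have "\<dots> = 1 + 2 * (w - 1) / (w + 1)" using w by (simp add: field_simps)
  also have "\<dots> \<le> 1 + ln w" using ln_ge_pade[OF w] by simp
  finally show ?thesis .
qed

text \<open>Concavity of \<open>ln\<close>: \<open>1 + a * p\<close> is the convex combination of
  \<open>1\<close> and \<open>1 + b * p\<close> with weight \<open>a / b\<close>.\<close>

lemma ln_over_id_antimono:
  fixes p a b :: real assumes "0 < p" "0 < a" "a \<le> b"
  shows "ln (1 + b * p) / b \<le> ln (1 + a * p) / a"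
proof -
  have "(1 - a / b) * ln 1 + (a / b) * ln (1 + b * p) \<le> ln ((1 - a / b) *\<^sub>R 1 + (a / b) *\<^sub>R (1 + b * p))"
    using assms by (intro concave_onD[OF ln_concave]) (auto simp: add_pos_pos)
  moreover have "(1 - a / b) *\<^sub>R 1 + (a / b) *\<^sub>R (1 + b * p) = 1 + a * p" using assms by (simp add: field_simps)
  ultimately have "(a / b) * ln (1 + b * p) \<le> ln (1 + a * p)"
    by (simp only: ln_one mult_zero_right add_0)
  then have "(a / b) * ln (1 + b * p) / a \<le> ln (1 + a * p) / a" using assms by (intro divide_right_mono) auto
  then show ?thesis using assms by simp
qed

lemma DERIV_ln_affine:
  fixes c x :: real assumes "0 < c" "0 \<le> x"
  shows "((\<lambda>x. ln (1 + c * x) / c) has_real_derivative 1 / (1 + c * x)) (at x)"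
proof -
  have "0 < 1 + c * x" using assms by (intro add_pos_nonneg) auto
  then have "((\<lambda>x. ln (1 + c * x) / c) has_real_derivative (1 / (1 + c * x) * c) / c) (at x)"
    by (intro DERIV_cdivide) (auto intro!: derivative_eq_intros)
  then show ?thesis using assms by simp
qed

section \<open>The lower bound for quasi-regular distributions\<close>

context valuation begin

text \<open>At the quantile \<open>q = G s\<close> this is the reciprocal of the quotient
  \<open>R(q) / (1 - q)\<close> in the definition of quasi-regularity.\<close>

definition y :: "real \<Rightarrow> real" where "y s = (1 / G s - 1) / s"

lemma quantile_val_cdf:
  assumes "vL < p" "ereal p < vH" shows "quantile_val M (G p) = p"
proof -
  have Gp: "1 - G p = cdf M p" using G_cdf[of p] assms by auto
  have "{v. cdf M p < cdf M v} = {p<..}"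
  proof (intro equalityI subsetI)
    fix v assume "v \<in> {v. cdf M p < cdf M v}"
    then show "v \<in> {p<..}" using cdf_nondecreasing[of v p] by (auto simp: not_le[symmetric])
  next
    fix v assume v: "v \<in> {p<..}"
    then have "ereal p < min (ereal v) vH" using assms by auto
    then obtain q where q: "ereal p < ereal q" "ereal q < min (ereal v) vH"
      using ereal_dense2 by blast
    then have "G q < G p" using assms by (intro G_strict) auto
    moreover have "cdf M q = 1 - G q" using G_cdf[of q] q by auto
    moreover have "cdf M q \<le> cdf M v" using q by (intro cdf_nondecreasing) auto
    ultimately show "v \<in> {v. cdf M p < cdf M v}" using Gp by auto
  qed
  then show ?thesis unfolding quantile_val_def Gp by simp
qed

text \<open>A higher price is a lower quantile, which reverses the order of the quotients; taking
  reciprocals restores it.\<close>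

lemma quasi_regular_y_mono:
  assumes qr: "quasi_regular_dist M" and ab: "vL < a" "a \<le> b" "ereal b < vH"
  shows "y a \<le> y b"
proof (cases "a = b")
  case False
  then have "a < b" using ab by simp
  have aH: "ereal a < vH" using ab less_vH by blast
  have G: "0 < G b" "G b < G a" "G a < 1" "0 < a" "0 < b"
    using G_pos[of b] G_strict[of a b] G_strict[of vL a] G_below[of vL] ab \<open>a < b\<close> aH vL_nonneg by auto
  have "rev_curve M (G b) / (1 - G b) \<le> rev_curve M (G a) / (1 - G a)"
    using qr G unfolding quasi_regular_dist_def by auto
  moreover have "rev_curve M (G a) = G a * a" "rev_curve M (G b) = G b * b"
    using quantile_val_cdf ab aH G by (auto simp: rev_curve_def)
  ultimately have "G b * b * (1 - G a) \<le> G a * a * (1 - G b)"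
    using G by (simp add: field_simps)
  moreover have "y s = (1 - G s) / (G s * s)" if "0 < G s" for s
    using that by (simp add: y_def field_simps)
  ultimately show ?thesis using G by (simp add: field_simps)
qed simp

lemma quasi_regular_ratio:
  assumes qr: "quasi_regular_dist M" and U: "achievable M U"
  shows "0.8246 \<le> ratio U"
proof -
  define k :: real where "k = 877 / 4123"
  have "1 / (1 + k) \<le> ratio U"
  proof (rule ratio_ge[OF U])
    fix p N
    assume id: "integrable M (\<lambda>v. v)" and p: "0 < p" "ereal p < vH"
      and N: "0 < N" "\<And>s. s \<le> p \<Longrightarrow> R s \<le> N"
    have kpos: "0 < k" by (simp add: k_def)
    have high1: "R s + 1 * (W s - W p) \<le> N" if "p \<le> s" for s
    proof -
      have "p * G s \<le> R p" unfolding R_def using p that by (intro mult_left_mono G_antimono) auto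
      moreover have "(s - p) * G s \<le> W p - W s" using W_diff[OF id that] by simp
      ultimately show ?thesis using N(2)[of p] by (simp add: R_def algebra_simps)
    qed
    show "\<exists>\<mu>\<in>{0..1}. \<forall>s. vL \<le> s \<longrightarrow> ereal s < vH \<longrightarrow> R s + \<mu> * (W s - W p) \<le> (1 + k) * N"
    proof (cases "p \<le> N")
      case True
      have "R s + 1 * (W s - W p) \<le> (1 + k) * N" if s: "vL \<le> s" for s
      proof -
        have "R s + 1 * (W s - W p) \<le> N"
        proof (cases "p \<le> s")
          case False
          have "W s - W p \<le> (p - s) * G s" using W_diff[OF id, of s p] False by simp
          then have "R s + (W s - W p) \<le> p * G s" by (simp add: R_def algebra_simps)
          also have "\<dots> \<le> p * 1" using p by (intro mult_left_mono) auto
          finally show ?thesis using True by simp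
        qed (rule high1)
        moreover have "0 \<le> k * N" using kpos N by simp
        ultimately show ?thesis by (simp add: algebra_simps)
      qed
      then show ?thesis by (intro bexI[of _ 1]) auto
    next
      case False
      then have pN: "N < p" by simp
      have pL: "vL < p"
      proof (rule ccontr)
        assume "\<not> vL < p"
        then show False using N(2)[of p] G_below[of p] pN by (simp add: R_def)
      qed
      define L where "L = ln (p / N)"
      have L: "0 < L" using pN N by (simp add: L_def)
      \<comment> \<open>Below \<open>p\<close> demand is at most \<open>N / x\<close>, so
        \<open>W + N * ln\<close> is nondecreasing.\<close>
      have W_log: "W s - W p \<le> N * ln (p / s)" if s: "0 < s" "s \<le> p" for s
      proof -
        have "W s + N * ln s \<le> W p + N * ln p"
        proof (rule nondecreasing_by_deriv[OF s(2)])
          show "continuous_on {s..p} (\<lambda>s. W s + N * ln s)"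
            using s by (intro continuous_intros W_cont id) auto
          fix x assume x: "s < x" "x < p"
          then have xH: "ereal x \<noteq> vH" using p less_vH by (metis less_imp_le order_less_irrefl)
          show "((\<lambda>s. W s + N * ln s) has_real_derivative - G x + N * (1 / x)) (at x)"
            using x s xH by (intro DERIV_add W_deriv id DERIV_cmult DERIV_ln_divide) auto
          show "0 \<le> - G x + N * (1 / x)"
            using N(2)[of x] x s by (simp add: R_def field_simps)
        qed
        then show ?thesis using s by (simp add: ln_div algebra_simps)
      qed
      \<comment> \<open>The split at \<open>N\<close> reflects the demand bound
        \<open>min 1 (N / s)\<close>: below \<open>N\<close> only \<open>G \<le> 1\<close> is
        informative.\<close>
      have low: "R s + \<mu> * (W s - W p) \<le> N + \<mu> * (N * L)"
        if s: "vL \<le> s" "s \<le> p" and mu: "0 \<le> \<mu>" "\<mu> \<le> 1" for s \<mu>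
      proof (cases "N \<le> s")
        case True
        have "W s - W p \<le> N * ln (p / s)" using W_log[of s] True N s by auto
        also have "\<dots> \<le> N * L" unfolding L_def using True N s p
          by (intro mult_left_mono) (auto simp: frac_le)
        finally have "\<mu> * (W s - W p) \<le> \<mu> * (N * L)" using mu by (intro mult_left_mono)
        then show ?thesis using N(2)[OF s(2)] by linarith
      next
        case False
        have "W s - W N \<le> (N - s) * G s" using W_diff[OF id, of s N] False by simp
        also have "\<dots> \<le> (N - s) * 1" using False by (intro mult_left_mono) auto
        finally have "W s - W p \<le> (N - s) + N * L" using W_log[of N] N pN by (simp add: L_def)
        then have "\<mu> * (W s - W p) \<le> \<mu> * ((N - s) + N * L)" using mu by (intro mult_left_mono)
        moreover have "\<mu> * (N - s) \<le> 1 * (N - s)" using mu False by (intro mult_right_mono) auto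
        moreover have "R s \<le> s * 1" unfolding R_def using s vL_nonneg by (intro mult_left_mono) auto
        ultimately show ?thesis by (simp add: algebra_simps)
      qed
      show ?thesis
      \<comment> \<open>If \<open>L \<le> k\<close>, low prices gain at most \<open>k * N\<close>
        even with the full multiplier 1.\<close>
      proof (cases "L \<le> k")
        case True
        have "R s + 1 * (W s - W p) \<le> (1 + k) * N" if s: "vL \<le> s" for s
        proof (cases "p \<le> s")
          case True
          have "0 \<le> k * N" using kpos N by simp
          then show ?thesis using high1[OF True] by (simp add: algebra_simps)
        next
          case False
          have "N * L \<le> N * k" using True N by (intro mult_left_mono) auto
          then show ?thesis using low[of s 1] s False by (simp add: algebra_simps)
        qed
        then show ?thesis by (intro bexI[of _ 1]) auto
      next
        case False
        \<comment> \<open>The largest multiplier for which \<open>low\<close> stays within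
          \<open>(1 + k) * N\<close>.\<close>
        define \<mu> where "\<mu> = k / L"
        have mu: "0 < \<mu>" "\<mu> \<le> 1" "\<mu> * L = k" using False kpos L by (auto simp: \<mu>_def)
        \<comment> \<open>The value that \<open>y p\<close> would take if \<open>R p = N\<close>;
          since \<open>R p \<le> N\<close>, it is a lower bound for \<open>y p\<close>.\<close>
        define y0 where "y0 = 1 / N - 1 / p"
        have y0: "0 < y0" "1 + y0 * p = p / N" using pN N p by (auto simp: y0_def field_simps)
        have Gp: "0 < G p" using G_pos p by blast
        have "G p \<le> N / p" using N(2)[of p] p by (simp add: R_def field_simps)
        then have "p / N \<le> 1 / G p" using Gp N p by (simp add: field_simps)
        then have y0_le: "y0 \<le> y p" using p N by (simp add: y_def y0_def field_simps)
        \<comment> \<open>Up to the factor \<open>\<mu>\<close> this is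
          \<open>quasi_regular_constant\<close> at \<open>1 / \<mu>\<close>, because
          \<open>k / \<mu> = L\<close> and \<open>exp (- L) = N / p\<close>.\<close>
        have key: "1 - \<mu> + \<mu> * ln \<mu> + k \<le> (1 + k) * N * y0"
        proof -
          have "(1 + k) * (1 / \<mu>) * exp (- (k * (1 / \<mu>))) \<le> 1 + ln (1 / \<mu>)"
            using quasi_regular_constant[of "1 / \<mu>"] mu by (simp add: k_def)
          moreover have "k * (1 / \<mu>) = L" using mu by (simp add: field_simps)
          moreover have "exp (- L) = N / p" using N p by (simp add: L_def exp_minus)
          moreover have "ln (1 / \<mu>) = - ln \<mu>" using mu by (simp add: ln_div)
          ultimately have "(1 + k) * (1 / \<mu>) * (N / p) \<le> 1 - ln \<mu>" by (simp only: diff_conv_add_uminus)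
          then have "\<mu> * ((1 + k) * (1 / \<mu>) * (N / p)) \<le> \<mu> * (1 - ln \<mu>)" using mu by (intro mult_left_mono) auto
          moreover have "\<mu> * ((1 + k) * (1 / \<mu>) * (N / p)) = (1 + k) * (N / p)" using mu by simp
          ultimately have "(1 + k) * (N / p) \<le> \<mu> * (1 - ln \<mu>)" by linarith
          moreover have "(1 + k) * N * y0 = (1 + k) - (1 + k) * (N / p)"
            using N p by (simp add: y0_def field_simps)
          ultimately show ?thesis by (simp add: algebra_simps)
        qed
        have "R s + \<mu> * (W s - W p) \<le> (1 + k) * N" if s: "p \<le> s" "ereal s < vH" for s
        proof -
          define Y where "Y = y s"
          have "y p \<le> Y" unfolding Y_def by (rule quasi_regular_y_mono[OF qr pL s])
          then have Y: "0 < Y" "y0 \<le> Y" using y0_le y0 by auto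
          have G_eq: "G x = 1 / (1 + y x * x)" if "p \<le> x" "x \<le> s" for x
          proof -
            have "0 < G x" using that s less_vH G_pos by blast
            then show ?thesis using that p by (simp add: y_def)
          qed
          \<comment> \<open>On \<open>{p..s}\<close> monotonicity of \<open>y\<close> gives
            \<open>G x \<ge> 1 / (1 + Y * x)\<close>, whose antiderivative is the added
            logarithm.\<close>
          have "W s + ln (1 + Y * s) / Y \<le> W p + ln (1 + Y * p) / Y"
          proof (rule nonincreasing_by_deriv[OF s(1)])
            have "0 < 1 + Y * x" if "p \<le> x" for x using Y p that by (intro add_pos_nonneg) auto
            then show "continuous_on {p..s} (\<lambda>x. W x + ln (1 + Y * x) / Y)"
              using Y by (intro continuous_intros W_cont id) force+
            fix x assume x: "p < x" "x < s"
            have xH: "ereal x < vH" using x s less_vH by auto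
            have "((\<lambda>x. ln (1 + Y * x) / Y) has_real_derivative 1 / (1 + Y * x)) (at x)"
              using Y p x by (intro DERIV_ln_affine) auto
            then show "((\<lambda>x. W x + ln (1 + Y * x) / Y) has_real_derivative - G x + 1 / (1 + Y * x)) (at x)"
              using xH by (intro DERIV_add W_deriv id) auto
            have "y x \<le> Y" "y p \<le> y x" unfolding Y_def
              using quasi_regular_y_mono[OF qr] pL x s xH by auto
            then have "0 < y x" using y0 y0_le by linarith
            have "1 / (1 + Y * x) \<le> 1 / (1 + y x * x)"
              using \<open>y x \<le> Y\<close> \<open>0 < y x\<close> x p by (intro frac_le add_left_mono mult_right_mono add_pos_nonneg) auto
            then show "- G x + 1 / (1 + Y * x) \<le> 0" using G_eq[of x] x by simp
          qed
          then have W: "W s - W p \<le> (ln (1 + Y * p) - ln (1 + Y * s)) / Y" by (simp add: diff_divide_distrib)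
          define z where "z = 1 + Y * s"
          have z: "1 \<le> z" using Y p s by (auto simp: z_def)
          \<comment> \<open>Maximises \<open>1 - 1 / z - \<mu> * ln z\<close> over \<open>z\<close>;
            the maximum is at \<open>z = 1 / \<mu>\<close>.\<close>
          have "ln (1 / (z * \<mu>)) \<le> 1 / (z * \<mu>) - 1" using z mu by (intro ln_le_minus_one) auto
          then have "1 - 1 / (z * \<mu>) \<le> ln z + ln \<mu>" using z mu by (simp add: ln_div ln_mult)
          then have "\<mu> * (1 - 1 / (z * \<mu>)) \<le> \<mu> * (ln z + ln \<mu>)" using mu by (intro mult_left_mono) auto
          moreover have "\<mu> * (1 - 1 / (z * \<mu>)) = \<mu> - 1 / z" using mu z by (simp add: field_simps)
          ultimately have tangent: "1 - 1 / z - \<mu> * ln z \<le> 1 - \<mu> + \<mu> * ln \<mu>" by (simp add: algebra_simps)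
          have "0 \<le> 1 - \<mu> + \<mu> * ln \<mu>"
          proof -
            have "ln (1 / \<mu>) \<le> 1 / \<mu> - 1" using mu by (intro ln_le_minus_one) auto
            then have "\<mu> * ln (1 / \<mu>) \<le> \<mu> * (1 / \<mu> - 1)" using mu by (intro mult_left_mono) auto
            moreover have "\<mu> * (1 / \<mu> - 1) = 1 - \<mu>" using mu by (simp add: field_simps)
            ultimately show ?thesis using mu by (simp add: ln_div)
          qed
          have Gs: "G s = 1 / z" using G_eq[of s] s by (simp add: z_def Y_def)
          have "1 - 1 / z = (z - 1) / z" using z(1) by (simp add: diff_divide_distrib)
          also have "z - 1 = Y * s" by (simp add: z_def)
          finally have "R s = (1 - 1 / z) / Y" using Gs Y by (simp add: R_def)
          moreover have "\<mu> * (W s - W p) \<le> \<mu> * ((ln (1 + Y * p) - ln z) / Y)"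
            using W mu unfolding z_def by (intro mult_left_mono) auto
          ultimately have "R s + \<mu> * (W s - W p) \<le> (1 - 1 / z) / Y + \<mu> * ((ln (1 + Y * p) - ln z) / Y)"
            by simp
          also have "\<dots> = (1 - 1 / z - \<mu> * ln z) / Y + \<mu> * (ln (1 + Y * p) / Y)"
            by (simp add: add_divide_distrib diff_divide_distrib algebra_simps)
          also have "\<dots> \<le> (1 - \<mu> + \<mu> * ln \<mu>) / Y + \<mu> * (ln (1 + Y * p) / Y)"
            using tangent Y by (intro add_right_mono divide_right_mono) auto
          \<comment> \<open>Both terms are nonincreasing in \<open>Y\<close>, so the worst case is
            the smallest value \<open>y0\<close>.\<close>
          also have "\<dots> \<le> (1 - \<mu> + \<mu> * ln \<mu>) / y0 + \<mu> * (ln (1 + y0 * p) / y0)"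
            using Y y0 p mu \<open>0 \<le> 1 - \<mu> + \<mu> * ln \<mu>\<close>
            by (intro add_mono frac_le mult_left_mono ln_over_id_antimono) auto
          also have "\<dots> = (1 - \<mu> + \<mu> * ln \<mu> + k) / y0"
            using mu y0 by (simp add: L_def[symmetric] add_divide_distrib)
          also have "\<dots> \<le> (1 + k) * N" using key y0 by (simp add: field_simps)
          finally show ?thesis .
        qed
        moreover have "R s + \<mu> * (W s - W p) \<le> (1 + k) * N" if s: "vL \<le> s" "s \<le> p" for s
        proof -
          have "R s + \<mu> * (W s - W p) \<le> N + \<mu> * (N * L)" using low[OF s, of \<mu>] mu(1,2) by simp
          also have "\<mu> * (N * L) = N * k" using mu(3) by (simp only: mult.left_commute[of \<mu>])
          finally show ?thesis by (simp add: algebra_simps)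
        qed
        ultimately have "R s + \<mu> * (W s - W p) \<le> (1 + k) * N" if "vL \<le> s" "ereal s < vH" for s
          using that linear[of p s] by blast
        then show ?thesis using mu by (intro bexI[of _ \<mu>]) auto
      qed
    qed
  qed (simp add: k_def)
  then show ?thesis by (simp add: k_def)
qed

end

section \<open>Distributions from survival functions\<close>

text \<open>Template for all example distributions: atomless on \<open>{1..T}\<close> with demand
  \<open>g\<close>. The bounded support gives a finite mean and, by compactness, a monopoly
  price.\<close>

locale survival_curve =
  fixes T :: real and g :: "real \<Rightarrow> real"
  assumes T: "1 < T" and g1: "g 1 = 1" and gT: "g T = 0"
    and g_strict: "\<And>a b. 1 \<le> a \<Longrightarrow> a < b \<Longrightarrow> b \<le> T \<Longrightarrow> g b < g a"
    and g_cont: "continuous_on {1..T} g"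
    and g_diff: "\<And>x. 1 < x \<Longrightarrow> x < T \<Longrightarrow> g differentiable (at x)"
begin

definition F :: "real \<Rightarrow> real" where "F x = 1 - g (max 1 (min T x))"
definition D :: "real measure" where "D = interval_measure F"

lemma g_antimono: "1 \<le> a \<Longrightarrow> a \<le> b \<Longrightarrow> b \<le> T \<Longrightarrow> g b \<le> g a"
  using g_strict[of a b] by (cases "a = b") auto

lemma F_mono: "x \<le> y \<Longrightarrow> F x \<le> F y"
  unfolding F_def using T by (intro diff_left_mono g_antimono) auto

lemma F_cont: "continuous_on UNIV F"
  unfolding F_def using T
  by (intro continuous_intros continuous_on_compose2[OF g_cont]) auto

lemma F_below: "x \<le> 1 \<Longrightarrow> F x = 0" and F_above: "T \<le> x \<Longrightarrow> F x = 1"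
  and F_mid: "1 \<le> x \<Longrightarrow> x \<le> T \<Longrightarrow> F x = 1 - g x"
  using T by (auto simp: F_def g1 gT)

lemma F_isCont: "isCont F x"
  using F_cont by (simp add: continuous_on_eq_continuous_at)

lemma F_at_bot: "(F \<longlongrightarrow> 0) at_bot"
  by (intro tendsto_eventually eventually_mono[OF eventually_le_at_bot[of 1]] F_below)

lemma F_at_top: "(F \<longlongrightarrow> 1) at_top"
  by (intro tendsto_eventually eventually_mono[OF eventually_ge_at_top[of T]] F_above)

lemma F_right: "continuous (at_right a) F"
  using F_isCont by (rule continuous_at_imp_continuous_at_within)

lemma D_dist: "real_distribution D"
  unfolding D_def by (intro real_distribution_interval_measure F_mono F_right F_at_bot F_at_top)

lemma D_cdf: "cdf D = F"
  unfolding D_def by (intro cdf_interval_measure F_mono F_right F_at_bot)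

interpretation D: real_distribution D by (rule D_dist)

lemma D_atomless: "measure D {x} = 0"
  using F_isCont D.isCont_cdf[of x] by (simp add: D_cdf)

lemma D_open: assumes "a < b" shows "measure D {a<..<b} = F b - F a"
proof -
  have "{a<..b} = {a<..<b} \<union> {b}" using assms by auto
  then have "measure D {a<..b} = measure D {a<..<b} + measure D {b}"
    by (simp only:) (intro D.finite_measure_Union, auto)
  then show ?thesis using D.cdf_diff_eq[OF assms] by (simp add: D_atomless D_cdf)
qed

lemma D_support: "measure D {1..T} = 1"
proof -
  have "1 = measure D {1<..<T}" using D_open[OF T] T by (simp add: F_above F_below)
  also have "\<dots> \<le> measure D {1..T}" by (intro D.finite_measure_mono) auto
  finally show ?thesis using D.prob_le_1[of "{1..T}"] by linarith
qed

lemma D_standard: "standard_dist D 1 (ereal T)"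
  unfolding standard_dist_def
proof (intro conjI allI impI D_dist)
  have "val_set 1 (ereal T) = {1..T}" by (auto simp: val_set_def)
  then show "measure D (val_set 1 (ereal T)) = 1" using D_support by simp
  show "0 < measure D {a<..<b}" if "1 \<le> a" "a < b" "ereal b \<le> ereal T" for a b
    using that g_strict[of a b] by (simp add: D_open F_mid)
  show "cdf D differentiable (at x)" if x: "1 < x" "ereal x < ereal T" for x
  proof -
    obtain c where "(g has_real_derivative c) (at x)"
      using g_diff[of x] x by (auto simp: real_differentiable_def)
    then have "((\<lambda>x. 1 - g x) has_real_derivative - c) (at x)" by (auto intro!: derivative_eq_intros)
    then have "(F has_real_derivative - c) (at x)"
      by (rule has_field_derivative_transform_within_open[where S="{1<..<T}"]) (use x F_mid in auto)
    then show ?thesis by (auto simp: D_cdf real_differentiable_def)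
  qed
  have "continuous_on {1..T} (\<lambda>p. p * (1 - F p))"
    by (intro continuous_intros continuous_on_subset[OF F_cont]) auto
  then obtain p where p: "p \<in> {1..T}" "\<And>s. s \<in> {1..T} \<Longrightarrow> s * (1 - F s) \<le> p * (1 - F p)"
    using continuous_attains_sup[of "{1..T}" "\<lambda>p. p * (1 - F p)"] T by auto
  have "1 \<le> p * (1 - F p)" using p(2)[of 1] T by (simp add: F_below)
  then have "s * (1 - F s) \<le> p * (1 - F p)" for s
    using p(2)[of s] F_below[of s] F_above[of s] by (cases "s < 1"; cases "T < s") auto
  then show "\<exists>p. \<forall>p'. p' * (1 - cdf D p') \<le> p * (1 - cdf D p)" by (auto simp: D_cdf)
qed (use T D_atomless in auto)

sublocale val: valuation D 1 "ereal T"
  by (intro valuation.intro valuation_axioms.intro D_dist D_standard)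

lemma D_admissible: "admissible_dist D"
  using D_standard by (auto simp: admissible_dist_def)

lemma D_integrable: "integrable D (\<lambda>v. v)"
proof (rule D.integrable_const_bound[where B=T])
  show "AE v in D. norm v \<le> T"
    using val.AE_val by (rule eventually_mono) (auto simp: val_set_def)
qed simp

lemma G_eq: "1 \<le> s \<Longrightarrow> s < T \<Longrightarrow> val.G s = g s"
  using val.G_cdf[of s] by (simp add: D_cdf F_mid)

text \<open>By the intermediate value theorem each quantile in the open unit interval is
  \<open>g a\<close> for some price \<open>a\<close>, which turns the condition on quantiles into
  one on prices, in reversed order. At quantile 0 \<open>rev_curve\<close> is 0.\<close>

lemma D_quasi_regular:
  assumes "\<And>a b. 1 < a \<Longrightarrow> a < b \<Longrightarrow> b < T \<Longrightarrow> b * g b * (1 - g a) \<le> a * g a * (1 - g b)"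
  shows "quasi_regular_dist D"
  unfolding quasi_regular_dist_def
proof (intro conjI allI impI D_admissible)
  have inv: "\<exists>a. 1 < a \<and> a < T \<and> q = g a \<and> rev_curve D q = a * g a" if q: "0 < q" "q < 1" for q
  proof -
    have "\<exists>a\<ge>1. a \<le> T \<and> g a = q" using q T g1 gT g_cont by (intro IVT2') auto
    then obtain a where a: "1 \<le> a" "a \<le> T" "g a = q" by blast
    then have "a \<noteq> 1" "a \<noteq> T" using q g1 gT by auto
    then have a': "1 < a" "a < T" using a by auto
    then have "quantile_val D q = a" using val.quantile_val_cdf[of a] G_eq[of a] a by simp
    then show ?thesis using a a' q by (intro exI[of _ a]) (auto simp: rev_curve_def)
  qed
  fix q q' :: real assume q: "0 \<le> q" "q < q'" "q' < 1"
  obtain b where b: "1 < b" "b < T" "q' = g b" "rev_curve D q' = b * g b" using inv[of q'] q by auto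
  show "rev_curve D q / (1 - q) \<le> rev_curve D q' / (1 - q')"
  proof (cases "q = 0")
    case True
    then show ?thesis using b q by (simp add: rev_curve_def)
  next
    case False
    then obtain a where a: "1 < a" "a < T" "q = g a" "rev_curve D q = a * g a" using inv[of q] q by auto
    have "b < a" using g_antimono[of a b] a b q by (cases "a \<le> b") auto
    then have "a * g a * (1 - g b) \<le> b * g b * (1 - g a)" using assms[of b a] a b by simp
    then show ?thesis using a b q by (simp add: divide_le_eq le_divide_eq)
  qed
qed

end

section \<open>The approximation ratio as an infimum of pointwise ratios\<close>

lemma standard_valuation: "standard_dist M vL vH \<Longrightarrow> valuation M vL vH"
  by (auto simp: valuation_def valuation_axioms_def standard_dist_def)

text \<open>\<open>ratio\<close> is a function of the measure and the level alone, so a single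
  infimum ranges over distributions with different supports.\<close>

lemma approx_ratio_eq:
  assumes sub: "\<F> \<subseteq> general_class"
  shows "approx_ratio \<F> = Inf {valuation.ratio M U |M U. M \<in> \<F> \<and> achievable M U}"
proof -
  have *: "valuation.ratio M U =
      Sup {revenue M m |m. m \<in> price_posting M \<and> ennreal U \<le> buyer_util M m} /
      Sup {revenue M m |m. m \<in> BIC_IR M \<and> ennreal U \<le> buyer_util M m}" if "M \<in> \<F>" for M U
  proof -
    obtain vL vH where "standard_dist M vL vH"
      using \<open>M \<in> \<F>\<close> sub by (auto simp: general_class_def admissible_dist_def)
    then interpret valuation M vL vH by (rule standard_valuation)
    show ?thesis by (simp add: ratio_def posted_revenues_def feasible_revenues_def)
  qed
  show ?thesis unfolding approx_ratio_def
    by (intro arg_cong[where f=Inf] Collect_cong ex_cong1) (auto simp: *)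
qed

lemma approx_ratio_le:
  assumes "\<F> \<subseteq> general_class" "M \<in> \<F>" "achievable M U"
  shows "approx_ratio \<F> \<le> valuation.ratio M U"
  unfolding approx_ratio_eq[OF assms(1)]
proof (rule cInf_lower)
  show "bdd_below {valuation.ratio M U |M U. M \<in> \<F> \<and> achievable M U}"
  proof (rule bdd_belowI[of _ 0], clarify)
    fix M U assume M: "M \<in> \<F>" "achievable M U"
    then obtain vL vH where "standard_dist M vL vH"
      using assms(1) by (auto simp: general_class_def admissible_dist_def)
    then interpret valuation M vL vH by (rule standard_valuation)
    show "0 \<le> ratio U" using ratio_bounds M by blast
  qed
qed (use assms in blast)

lemma approx_ratio_ge:
  assumes "\<F> \<subseteq> general_class" "M \<in> \<F>" "achievable M U"
    and "\<And>M vL vH U. M \<in> \<F> \<Longrightarrow> standard_dist M vL vH \<Longrightarrow> achievable M U \<Longrightarrow> c \<le> valuation.ratio M U"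
  shows "c \<le> approx_ratio \<F>"
  unfolding approx_ratio_eq[OF assms(1)]
proof (rule cInf_greatest)
  show "{valuation.ratio M U |M U. M \<in> \<F> \<and> achievable M U} \<noteq> {}" using assms(2,3) by blast
  fix r assume "r \<in> {valuation.ratio M U |M U. M \<in> \<F> \<and> achievable M U}"
  then obtain M U where M: "r = valuation.ratio M U" "M \<in> \<F>" "achievable M U" by blast
  then obtain vL vH where "standard_dist M vL vH"
    using assms(1) by (auto simp: general_class_def admissible_dist_def)
  then show "c \<le> r" using assms(4) M by blast
qed

section \<open>Demand with a vanishing ratio\<close>

context survival_curve begin

lemma W_mid_pos: assumes "1 \<le> p" "p < T" shows "0 < val.W p"
proof -
  obtain q where "p < q" "q < T" using dense[OF assms(2)] by blast
  then show ?thesis using val.W_strict[OF D_integrable, of p q] val.W_nonneg[of q] by simp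
qed

lemma R_eq: "1 \<le> s \<Longrightarrow> s < T \<Longrightarrow> val.R s = s * g s"
  by (simp add: val.R_def G_eq)

lemma R_le_1: assumes "s \<le> 1" shows "val.R s \<le> 1"
proof (cases "0 \<le> s")
  case True
  then have "s * val.G s \<le> 1 * 1" using assms by (intro mult_mono) auto
  then show ?thesis by (simp add: val.R_def)
next
  case False
  then have "s * val.G s \<le> 0" by (intro mult_nonpos_nonneg) auto
  then show ?thesis by (simp add: val.R_def)
qed

text \<open>The surplus difference is the integral of \<open>g\<close>; comparison with an
  antiderivative \<open>H\<close> of a bound \<open>h\<close> avoids integrating \<open>g\<close>
  itself.\<close>

lemma W_decrease_le:
  assumes ab: "1 \<le> a" "a \<le> b" "b < T"
    and H: "\<And>x. a \<le> x \<Longrightarrow> x \<le> b \<Longrightarrow> (H has_real_derivative h x) (at x)"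
    and le: "\<And>x. a \<le> x \<Longrightarrow> x \<le> b \<Longrightarrow> g x \<le> h x"
  shows "val.W a - val.W b \<le> H b - H a"
proof -
  have "continuous_on {a..b} H"
    using H by (intro DERIV_continuous_on) (auto intro: DERIV_subset)
  then have "val.W a + H a \<le> val.W b + H b"
    using ab H le
    by (intro nondecreasing_by_deriv[of a b "\<lambda>x. val.W x + H x" "\<lambda>x. - val.G x + h x"]
        continuous_intros val.W_cont DERIV_add val.W_deriv D_integrable) (auto simp: G_eq)
  then show ?thesis by simp
qed

lemma W_decrease_ge:
  assumes ab: "1 \<le> a" "a \<le> b" "b < T"
    and H: "\<And>x. a \<le> x \<Longrightarrow> x \<le> b \<Longrightarrow> (H has_real_derivative h x) (at x)"
    and le: "\<And>x. a \<le> x \<Longrightarrow> x \<le> b \<Longrightarrow> h x \<le> g x"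
  shows "H b - H a \<le> val.W a - val.W b"
proof -
  have "continuous_on {a..b} H"
    using H by (intro DERIV_continuous_on) (auto intro: DERIV_subset)
  then have "val.W b + H b \<le> val.W a + H a"
    using ab H le
    by (intro nonincreasing_by_deriv[of a b "\<lambda>x. val.W x + H x" "\<lambda>x. - val.G x + h x"]
        continuous_intros val.W_cont DERIV_add val.W_deriv D_integrable) (auto simp: G_eq)
  then show ?thesis by simp
qed

end

text \<open>The uniform distribution on \<open>{1..2}\<close>, with virtual value
  \<open>2 * v - 2\<close>. It keeps the infima from ranging over an empty set.\<close>

lemma regular_class_nonempty: "\<exists>M U. M \<in> regular_class \<and> achievable M U"
proof -
  interpret survival_curve 2 "\<lambda>s. 2 - s"
    by unfold_locales (auto intro!: continuous_intros derivative_intros)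
  have deriv: "deriv F v = 1" if "1 < v" "v < 2" for v
  proof (rule DERIV_imp_deriv)
    have "((\<lambda>x. x - 1) has_real_derivative 1) (at v)" by (auto intro!: derivative_eq_intros)
    then show "(F has_real_derivative 1) (at v)"
      by (rule has_field_derivative_transform_within_open[where S="{1<..<2}"]) (use that F_mid in auto)
  qed
  have "mono_on {x. 1 < x \<and> ereal x < ereal 2} (\<lambda>v. v - (1 - cdf D v) / deriv (cdf D) v)"
    by (intro mono_onI) (auto simp: deriv D_cdf F_mid)
  then have "regular_dist D" using D_standard unfolding regular_dist_def by blast
  then have "D \<in> regular_class" using D_admissible by (simp add: regular_class_def)
  moreover have "achievable D 0"
  proof -
    have "val.W 0 > 0" using W_mid_pos[of 1] val.W_antimono[OF D_integrable, of 0 1] by simp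
    then show ?thesis
      using val.W_below[OF D_integrable, of 0] by (simp add: achievable_def val.mean_finite[OF D_integrable])
  qed
  ultimately show ?thesis by blast
qed

text \<open>Posted prices up to \<open>p\<close> earn at most 2. The lottery over the prices 1 and
  \<open>T / 2\<close> has revenue of order \<open>n\<close>, since \<open>T / 2\<close> earns at
  least \<open>n / 4\<close> and its surplus loss \<open>B\<close> is at most
  \<open>8 * A\<close>.\<close>

lemma general_example:
  fixes n :: nat assumes n: "4 \<le> n"
  shows "approx_ratio general_class \<le> 72 / n"
proof -
  define p where "p = exp (real n)"
  define T where "T = p * n"
  define d where "d = 1 / p"
  \<comment> \<open>The linear factor closes the support at \<open>T\<close> and costs only a
    constant up to \<open>T / 2\<close>. The tail \<open>d\<close> adds at most
    \<open>d * p = 1\<close> to revenue up to \<open>p\<close>, but \<open>d * T = n\<close> gives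
    revenue of order \<open>n\<close> at \<open>T / 2\<close>.\<close>
  define g where "g s = (T - s) / (T - 1) * ((1 - d) / s + d)" for s
  have "1 + real n \<le> p" unfolding p_def by (rule exp_ge_add_one_self)
  then have p: "5 \<le> p" using n by simp
  have "p * 4 \<le> T" unfolding T_def using p n by (intro mult_left_mono) auto
  then have T4: "4 * p \<le> T" by simp
  have d: "0 < d" "d \<le> 1 / 2" "d * p = 1" "d * T = n" using p by (auto simp: d_def T_def field_simps)
  have lnp: "ln p = n" by (simp add: p_def)
  interpret survival_curve T g
  proof
    show "1 < T" "g 1 = 1" "g T = 0" using T4 p by (auto simp: g_def)
    show "g b < g a" if ab: "1 \<le> a" "a < b" "b \<le> T" for a b
    proof -
      have "(T - b) / (T - 1) < (T - a) / (T - 1)" using ab T4 p by (intro divide_strict_right_mono) auto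
      moreover have "(1 - d) / b + d \<le> (1 - d) / a + d" using ab d by (intro add_right_mono divide_left_mono) auto
      moreover have "0 < (1 - d) / b + d" using ab d by (intro add_nonneg_pos) auto
      moreover have "0 \<le> (T - b) / (T - 1)" using ab T4 p by simp
      ultimately show ?thesis unfolding g_def by (intro mult_less_le_imp_less) auto
    qed
    show "continuous_on {1..T} g" unfolding g_def using T4 p by (intro continuous_intros) auto
    show "g differentiable (at x)" if "1 < x" "x < T" for x
      unfolding g_def using T4 p that by (intro derivative_intros) auto
  qed
  define A where "A = val.W 1 - val.W p"
  define B where "B = val.W p - val.W (T / 2)"
  have Tp: "2 * p \<le> T" "p < T / 2" "T / 2 < T" "p < T" using T4 p by auto
  have "ln p / 4 - ln 1 / 4 \<le> A" unfolding A_def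
  proof (rule W_decrease_ge)
    fix x assume x: "1 \<le> x" "x \<le> p"
    show "((\<lambda>x. ln x / 4) has_real_derivative (1 / x) / 4) (at x)"
      using x by (intro DERIV_cdivide DERIV_ln_divide) auto
    have "1 / 2 * ((1 / 2) / x) \<le> g x" unfolding g_def
    proof (rule mult_mono)
      show "1 / 2 \<le> (T - x) / (T - 1)" using x Tp p by (simp add: field_simps)
      have "(1 / 2) / x \<le> (1 - d) / x" using x d by (intro divide_right_mono) auto
      then show "(1 / 2) / x \<le> (1 - d) / x + d" using d by simp
    qed (use x Tp in auto)
    then show "(1 / x) / 4 \<le> g x" by simp
  qed (use p Tp in auto)
  then have A: "n / 4 \<le> A" by (simp add: lnp)
  have "B \<le> (ln (T / 2) + d * (T / 2)) - (ln p + d * p)" unfolding B_def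
  proof (rule W_decrease_le)
    fix x assume x: "p \<le> x" "x \<le> T / 2"
    show "((\<lambda>x. ln x + d * x) has_real_derivative (1 / x + d)) (at x)"
      using x p by (auto intro!: derivative_eq_intros)
    have "(T - x) / (T - 1) * ((1 - d) / x + d) \<le> 1 * (1 / x + d)"
      using x p d Tp by (intro mult_mono add_right_mono divide_right_mono) auto
    then show "g x \<le> 1 / x + d" by (simp add: g_def)
  qed (use p Tp in auto)
  also have "\<dots> \<le> ln T + d * T - ln p"
    using d p Tp by (intro diff_mono add_mono) (auto simp: mult_left_mono)
  also have "\<dots> = ln n + n" using p n d lnp by (simp add: T_def ln_mult)
  also have "\<dots> \<le> 2 * n" using ln_le_minus_one[of "real n"] n by simp
  finally have B: "B \<le> 2 * n" .
  have B0: "0 \<le> B" unfolding B_def using val.W_antimono[OF D_integrable, of p "T / 2"] Tp by simp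
  have "n / 4 = T / 2 * (1 / 2 * d)" using d by (simp add: algebra_simps)
  also have "\<dots> \<le> T / 2 * g (T / 2)"
  proof (rule mult_left_mono)
    show "1 / 2 * d \<le> g (T / 2)" unfolding g_def
      using d Tp p by (intro mult_mono) (auto simp: field_simps)
  qed (use p Tp in auto)
  also have "\<dots> = val.R (T / 2)" using Tp p by (simp add: R_eq)
  finally have R2: "n / 4 \<le> val.R (T / 2)" .
  have R_le: "val.R s \<le> 2" if "s \<le> p" for s
  proof (cases "s \<le> 1")
    case False
    have "s * g s = (T - s) / (T - 1) * (s * ((1 - d) / s + d))" by (simp add: g_def)
    also have "s * ((1 - d) / s + d) = (1 - d) + d * s" using False by (simp add: field_simps)
    also have "(T - s) / (T - 1) * \<dots> \<le> 1 * (1 + d * p)"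
      using False that d Tp p by (intro mult_mono add_mono mult_left_mono add_nonneg_nonneg) auto
    finally show ?thesis using False that Tp d by (simp add: R_eq)
  qed (use R_le_1[of s] in simp)
  have R1: "val.R 1 = 1" using T p g1 by (simp add: R_eq)
  have Apos: "0 < A" and nA: "real n \<le> 4 * A" using A n by auto
  have B8: "B \<le> 8 * A" using B nA by simp
  have AR: "A * (n / 4) \<le> A * val.R (T / 2)" using R2 Apos by (intro mult_left_mono) auto
  have pos: "0 < A * (n / 4)" using Apos n by simp
  have D_gen: "D \<in> general_class" using D_admissible by (simp add: general_class_def)
  have price: "1 < p" "p < T / 2" "ereal p < ereal T" "0 < val.W p" "0 < p" using Tp p W_mid_pos[of p] by auto
  have mix_ge: "A * (n / 4) \<le> A * val.R (T / 2) + B * val.R 1" using AR B0 unfolding R1 by linarith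
  with pos have mix: "0 < A * val.R (T / 2) + B * val.R 1" by linarith
  note lottery = val.ratio_le_lottery[OF D_integrable price R_le A_def B_def Apos B0 mix]
  have "approx_ratio general_class \<le> val.ratio (val.W p)"
    using approx_ratio_le[OF subset_refl D_gen lottery(1)] .
  also note lottery(2)
  also have "2 * (A + B) / (A * val.R (T / 2) + B * val.R 1) \<le> 2 * (A + 8 * A) / (A * (n / 4))"
    using B8 Apos by (intro frac_le mix_ge pos) auto
  also have "\<dots> = 72 / n" using Apos n by (simp add: field_simps)
  finally show ?thesis .
qed

section \<open>Quasi-regular demand with a small ratio\<close>

lemma DERIV_max_0_square:
  "((\<lambda>x. (max 0 (x - c))^2) has_real_derivative 2 * max 0 (x - c)) (at x)" for x c :: real
proof (cases x c rule: linorder_cases)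
  case less
  have "((\<lambda>x. 0) has_real_derivative 2 * max 0 (x - c)) (at x)" using less by simp
  then show ?thesis
    by (rule has_field_derivative_transform_within_open[where S="{..<c}"]) (use less in auto)
next
  case greater
  have "((\<lambda>x. (x - c)^2) has_real_derivative 2 * max 0 (x - c)) (at x)"
    using greater by (auto intro!: derivative_eq_intros)
  then show ?thesis
    by (rule has_field_derivative_transform_within_open[where S="{c<..}"]) (use greater in auto)
next
  case equal
  have "((\<lambda>h. (max 0 h)^2 / h) \<longlongrightarrow> 0) (at (0::real))"
  proof (rule Lim_null_comparison)
    show "\<forall>\<^sub>F h in at (0::real). norm ((max 0 h)^2 / h) \<le> \<bar>h\<bar>"
      by (rule always_eventually) (auto simp: max_def power2_eq_square)
    show "((\<lambda>h::real. \<bar>h\<bar>) \<longlongrightarrow> 0) (at 0)" by (rule tendsto_rabs_zero) simp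
  qed
  then show ?thesis using equal by (simp add: DERIV_def)
qed

text \<open>A continuously differentiable replacement for \<open>min s 1.7\<close>; the resulting survival function
  \<open>1 / (1 + s - s / cap s)\<close> follows the equal-revenue curve \<open>1 / s\<close> up to \<open>1.7\<close> and is then proportional to
  the boundary case \<open>s \<mapsto> 1 / (1 + c s)\<close> of quasi-regularity.\<close>

definition cap :: "real \<Rightarrow> real" where
  "cap s = s - (max 0 (s - 1.7))^2 * 250000 + (max 0 (s - 1.700002))^2 * 250000"

text \<open>The slope falls linearly from 1 at \<open>1.7\<close> to 0 at \<open>1.700002\<close>,
  as \<open>2 * 0.000002 * 250000 = 1\<close>, so \<open>cap\<close> levels off at
  \<open>1.700001\<close>.\<close>

lemma cap_deriv:
  "(cap has_real_derivative (1 - (2 * max 0 (s - 1.7)) * 250000 + (2 * max 0 (s - 1.700002)) * 250000)) (at s)"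
  unfolding cap_def[abs_def]
  by (intro DERIV_add DERIV_diff DERIV_ident DERIV_cmult_right DERIV_max_0_square)

lemma cap_mono: assumes "a \<le> b" shows "cap a \<le> cap b"
proof (rule nondecreasing_by_deriv[OF assms _ cap_deriv])
  show "continuous_on {a..b} cap"
    using cap_deriv by (intro DERIV_continuous_on) (auto intro: DERIV_subset)
  show "0 \<le> 1 - (2 * max 0 (s - 1.7)) * 250000 + (2 * max 0 (s - 1.700002)) * 250000" for s :: real
    by (auto simp: max_def)
qed

lemma cap_low: "s \<le> 1.7 \<Longrightarrow> cap s = s"
  by (simp add: cap_def)

lemma cap_high: "1.700002 \<le> s \<Longrightarrow> cap s = 1.700001"
  by (simp add: cap_def power2_eq_square algebra_simps)

lemma cap_ge_1: "1 \<le> s \<Longrightarrow> 1 \<le> cap s"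
  using cap_mono[of 1 s] cap_low[of 1] by simp

text \<open>The last term makes the support bounded; it is inactive below the price \<open>5.1\<close>.\<close>

definition odds :: "real \<Rightarrow> real" where
  "odds s = 1 - 1 / cap s + (max 0 (s - 5.1))^2 / (6.1 - s)"

text \<open>This is \<open>1 / (1 + s * odds s)\<close> with the pole of \<open>odds\<close> at
  \<open>6.1\<close> cleared, so that the formula also gives the value 0 at the end point.\<close>

definition surv :: "real \<Rightarrow> real" where
  "surv s = (6.1 - s) / ((6.1 - s) * (1 + s - s / cap s) + s * (max 0 (s - 5.1))^2)"

lemma odds_mono: assumes "1 \<le> a" "a \<le> b" "b < 6.1" shows "odds a \<le> odds b"
  unfolding odds_def
proof (intro add_mono diff_left_mono)
  show "1 / cap b \<le> 1 / cap a" using assms cap_mono[of a b] cap_ge_1[of a] by (intro divide_left_mono) auto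
  show "(max 0 (a - 5.1))^2 / (6.1 - a) \<le> (max 0 (b - 5.1))^2 / (6.1 - b)"
    using assms by (intro frac_le power_mono) auto
qed

lemma odds_1: "odds 1 = 0"
  by (simp add: odds_def cap_low)

lemma odds_pos: assumes "1 < a" "a < 6.1" shows "0 < odds a"
proof -
  have "0 < 1 - 1 / min a 1.7" using assms by (auto simp: min_def)
  also have "\<dots> = odds (min a 1.7)" by (simp add: odds_def cap_low)
  also have "\<dots> \<le> odds a" using assms by (intro odds_mono) auto
  finally show ?thesis .
qed

lemma odds_nonneg: "1 \<le> a \<Longrightarrow> a < 6.1 \<Longrightarrow> 0 \<le> odds a"
  using odds_mono[of 1 a] odds_1 by simp

lemma surv_eq: assumes "1 \<le> s" "s < 6.1" shows "surv s = 1 / (1 + s * odds s)"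
proof -
  have "d * (1 + s - s / c) + s * q = d * (1 + s * (1 - 1 / c + q / d))" if "d \<noteq> 0" for c d q :: real
    using that by (simp add: algebra_simps)
  from this[of "6.1 - s" "cap s" "(max 0 (s - 5.1))^2"]
  have "(6.1 - s) * (1 + s - s / cap s) + s * (max 0 (s - 5.1))^2 = (6.1 - s) * (1 + s * odds s)"
    using assms unfolding odds_def by simp
  then show ?thesis using assms unfolding surv_def by simp
qed

lemma surv_end: "surv 6.1 = 0"
  by (simp add: surv_def)

lemma surv_denom_pos:
  assumes "1 \<le> s" "s \<le> 6.1" shows "0 < (6.1 - s) * (1 + s - s / cap s) + s * (max 0 (s - 5.1))^2"
proof (cases "s = 6.1")
  case False
  have "s / cap s \<le> s" using assms cap_ge_1[of s] by (simp add: divide_le_eq)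
  then have "0 < (6.1 - s) * (1 + s - s / cap s)" using assms False by (intro mult_pos_pos) auto
  then show ?thesis using assms by (intro add_pos_nonneg) auto
next
  case True
  show ?thesis unfolding True by simp
qed

interpretation Q: survival_curve "6.1" surv
proof
  show "surv 1 = 1" by (simp add: surv_eq odds_1)
  show "surv b < surv a" if ab: "1 \<le> a" "a < b" "b \<le> 6.1" for a b
  proof (cases "b = 6.1")
    case True
    have "0 < 1 + a * odds a" using ab odds_nonneg[of a] by (intro add_pos_nonneg) auto
    then have "0 < surv a" using ab by (simp add: surv_eq)
    then show ?thesis unfolding True surv_end .
  next
    case False
    have "a * odds a \<le> a * odds b" using ab False by (intro mult_left_mono odds_mono) auto
    also have "\<dots> < b * odds b" using ab False by (intro mult_strict_right_mono odds_pos) auto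
    finally have "a * odds a < b * odds b" .
    moreover have "0 \<le> a * odds a" using ab odds_nonneg[of a] by simp
    ultimately show ?thesis using ab False by (simp add: surv_eq frac_less2)
  qed
  have nz: "cap x \<noteq> 0" if "1 \<le> x" for x using cap_ge_1[OF that] by simp
  have dcap: "cap differentiable (at x)" for x using cap_deriv real_differentiable_def by blast
  have dsq: "(\<lambda>x. (max 0 (x - 5.1))^2) differentiable (at x)" for x :: real
    using DERIV_max_0_square real_differentiable_def by blast
  have diff: "surv differentiable (at x)" if "1 \<le> x" "x \<le> 6.1" for x
    unfolding surv_def[abs_def] using that surv_denom_pos[OF that] nz[OF that(1)]
    by (intro differentiable_divide differentiable_add differentiable_mult differentiable_diff
        dcap dsq differentiable_ident differentiable_const) auto
  show "surv differentiable (at x)" if "1 < x" "x < 6.1" for x using that by (intro diff) auto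
  show "continuous_on {1..6.1} surv"
    using diff by (intro continuous_at_imp_continuous_on ballI differentiable_imp_continuous_within) auto
qed (simp_all add: surv_end)

text \<open>Since \<open>1 - surv s = s * odds s * surv s\<close>, the condition on prices is
  monotonicity of \<open>odds\<close> times a common nonnegative factor.\<close>

lemma Q_quasi_regular: "quasi_regular_dist Q.D"
proof (rule Q.D_quasi_regular)
  fix a b :: real assume ab: "1 < a" "a < b" "b < 6.1"
  have pos: "0 < 1 + a * odds a" "0 < 1 + b * odds b"
    using ab odds_pos[of a] odds_pos[of b] by (auto intro: add_pos_pos)
  have "1 - surv a = a * odds a * surv a" "1 - surv b = b * odds b * surv b"
    using ab pos by (auto simp: surv_eq field_simps)
  moreover have "odds a * (a * b * surv a * surv b) \<le> odds b * (a * b * surv a * surv b)"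
    using ab pos by (intro mult_right_mono odds_mono) (auto simp: surv_eq)
  ultimately show "b * surv b * (1 - surv a) \<le> a * surv a * (1 - surv b)" by (simp only: ac_simps)
qed

section \<open>Numerical evaluation of the quasi-regular example\<close>

lemma ln_17_10: "0.5306282 \<le> ln (1.7 :: real)"
  using ln_approx_bounds[of "1.7" 6] by (simp add: eval_nat_numeral)

lemma ln_31_17: "ln (31 / 17 :: real) \<le> 0.6007739"
  using ln_approx_bounds[of "31 / 17" 6] by (simp add: eval_nat_numeral)

text \<open>Posted prices up to \<open>1.7\<close> earn at most 1 on the equal-revenue part. They
  are compared with the lottery over the prices 1 and \<open>5.1\<close>, which has the same surplus
  as \<open>1.7\<close>.\<close>

lemma Q_ratio:
  shows "achievable Q.D (Q.val.W 1.7)" "Q.val.ratio (Q.val.W 1.7) \<le> 0.8532"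
proof -
  define A where "A = Q.val.W 1 - Q.val.W 1.7"
  define B where "B = Q.val.W 1.7 - Q.val.W 5.1"
  have low: "surv s = 1 / s" if "1 \<le> s" "s \<le> 1.7" for s
    using that by (simp add: surv_eq odds_def cap_low field_simps)
  have "ln 1.7 - ln 1 \<le> A" unfolding A_def
    by (rule Q.W_decrease_ge[where h="\<lambda>x. 1 / x"]) (auto intro!: DERIV_ln_divide simp: low)
  then have A: "0.5306282 \<le> A" using ln_17_10 by simp
  \<comment> \<open>\<open>7 / 17\<close> is \<open>1 - 1 / 1.7\<close>, the value of
    \<open>odds\<close> at \<open>1.7\<close> and hence a lower bound for it beyond.\<close>
  have "B \<le> ln (1 + 7 / 17 * 5.1) / (7 / 17) - ln (1 + 7 / 17 * 1.7) / (7 / 17)" unfolding B_def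
  proof (rule Q.W_decrease_le[where h="\<lambda>x. 1 / (1 + 7 / 17 * x)"])
    fix x :: real assume x: "1.7 \<le> x" "x \<le> 5.1"
    show "((\<lambda>x. ln (1 + 7 / 17 * x) / (7 / 17)) has_real_derivative 1 / (1 + 7 / 17 * x)) (at x)"
      using x by (intro DERIV_ln_affine) auto
    have "7 / 17 = odds 1.7" by (simp add: odds_def cap_low)
    also have "\<dots> \<le> odds x" using x by (intro odds_mono) auto
    finally have "x * (7 / 17) \<le> x * odds x" using x by (intro mult_left_mono) auto
    then show "surv x \<le> 1 / (1 + 7 / 17 * x)" using x by (simp add: surv_eq frac_le)
  qed auto
  also have "\<dots> = (ln ((31 / 10) / (17 / 10)) :: real) * (17 / 7)"
    by (subst ln_div) (simp_all add: diff_divide_distrib algebra_simps)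
  also have "\<dots> = ln (31 / 17) * (17 / 7)" by simp
  finally have B: "B \<le> 0.6007739 * (17 / 7)" using ln_31_17 by simp
  have B0: "0 \<le> B" unfolding B_def using Q.val.W_antimono[OF Q.D_integrable, of "1.7" "5.1"] by simp
  have R1: "Q.val.R 1 = 1" by (simp add: Q.R_eq low)
  define r where "r = Q.val.R 5.1"
  have r: "r = 5.1 / (1 + 5.1 * (1 - 1 / 1.700001))"
    by (simp add: r_def Q.R_eq surv_eq odds_def cap_high)
  have "Q.val.R s \<le> 1" if "s \<le> 1.7" for s
    using Q.R_le_1[of s] that low[of s] by (cases "s \<le> 1") (auto simp: Q.R_eq)
  note R_le = this
  have price: "1 < (1.7 :: real)" "1.7 < (5.1 :: real)" "ereal 1.7 < ereal 6.1" "0 < Q.val.W 1.7" "0 < (1.7 :: real)"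
    using Q.W_mid_pos[of "1.7"] by auto
  have "0 < A" using A by simp
  have r_pos: "0 < r" by (simp add: r)
  have mix: "0 < A * Q.val.R 5.1 + B * Q.val.R 1"
    using r_pos \<open>0 < A\<close> B0 by (simp add: R1 r_def[symmetric] add_pos_nonneg)
  note lottery = Q.val.ratio_le_lottery[OF Q.D_integrable price R_le A_def B_def \<open>0 < A\<close> B0 mix]
  show "achievable Q.D (Q.val.W 1.7)" by (rule lottery(1))
  \<comment> \<open>The claim \<open>A + B \<le> 0.8532 * (A * r + B)\<close> with \<open>B\<close>
    collected on the left, where \<open>0.1468 = 1 - 0.8532\<close>.\<close>
  have "0.1468 * B \<le> 0.1468 * (0.6007739 * (17 / 7))" using B by simp
  also have "\<dots> \<le> 0.5306282 * (0.8532 * r - 1)" by (simp add: r)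
  also have "\<dots> \<le> A * (0.8532 * r - 1)" using A by (intro mult_right_mono) (auto simp: r)
  finally have "A + B \<le> 0.8532 * (A * r + B)" by (simp add: algebra_simps)
  then have "1 * (A + B) / (A * Q.val.R 5.1 + B * Q.val.R 1) \<le> 0.8532"
    using mix by (simp add: R1 r_def divide_le_eq)
  with lottery(2) show "Q.val.ratio (Q.val.W 1.7) \<le> 0.8532" by linarith
qed

theorem theoremF1:
  shows "approx_ratio general_class = 0
       \<and> 0.8246 \<le> approx_ratio quasi_regular_class
       \<and> approx_ratio quasi_regular_class \<le> 0.8532
       \<and> approx_ratio regular_class = 1"
proof (intro conjI)
  obtain M U where reg: "M \<in> regular_class" "achievable M U" using regular_class_nonempty by blast
  have sub: "regular_class \<subseteq> general_class" "quasi_regular_class \<subseteq> general_class"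
    by (auto simp: regular_class_def quasi_regular_class_def quasi_regular_dist_def general_class_def)
  have Q: "Q.D \<in> quasi_regular_class" using Q_quasi_regular by (simp add: quasi_regular_class_def)
  show "approx_ratio general_class = 0"
  proof (rule antisym)
    show "0 \<le> approx_ratio general_class"
    proof (rule approx_ratio_ge)
      show "M \<in> general_class" "achievable M U" using reg sub by auto
      fix M vL vH U assume "standard_dist M vL vH" "achievable M U"
      then show "0 \<le> valuation.ratio M U"
        using valuation.ratio_bounds(1) standard_valuation by blast
    qed simp
    show "approx_ratio general_class \<le> 0"
    proof (rule tendsto_lowerbound)
      show "(\<lambda>n. 72 / real n) \<longlonglongrightarrow> 0" by (rule lim_const_over_n)
      show "\<forall>\<^sub>F n in sequentially. approx_ratio general_class \<le> 72 / real n"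
        using eventually_ge_at_top[of 4] by (rule eventually_mono) (rule general_example)
    qed simp
  qed
  show "0.8246 \<le> approx_ratio quasi_regular_class"
  proof (rule approx_ratio_ge[OF sub(2) Q Q_ratio(1)])
    fix M vL vH U assume *: "M \<in> quasi_regular_class" "standard_dist M vL vH" "achievable M U"
    interpret valuation M vL vH using * by (intro standard_valuation)
    show "0.8246 \<le> ratio U" using quasi_regular_ratio * by (simp add: quasi_regular_class_def)
  qed
  show "approx_ratio quasi_regular_class \<le> 0.8532"
    using approx_ratio_le[OF sub(2) Q Q_ratio(1)] Q_ratio(2) by simp
  have reg1: "valuation.ratio M U = 1" if M: "M \<in> regular_class" and U: "achievable M U" for M U
  proof -
    obtain vL vH where std: "standard_dist M vL vH"
      and mono: "mono_on {x. vL < x \<and> ereal x < vH} (\<lambda>v. v - (1 - cdf M v) / deriv (cdf M) v)"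
      using M by (auto simp: regular_class_def regular_dist_def)
    interpret valuation M vL vH using std by (rule standard_valuation)
    \<comment> \<open>\<open>\<phi>\<close> is written with \<open>G\<close>, which agrees with
      \<open>1 - cdf M\<close> below \<open>vH\<close>.\<close>
    have "\<phi> v = v - (1 - cdf M v) / deriv (cdf M) v" if "ereal v < vH" for v
      using that G_cdf[of v] by (auto simp: \<phi>_def f_def)
    then have "mono_on {x. vL < x \<and> ereal x < vH} \<phi>"
      using mono by (simp add: mono_on_def)
    then show ?thesis using regular_ratio U by blast
  qed
  show "approx_ratio regular_class = 1"
  proof (rule antisym)
    show "approx_ratio regular_class \<le> 1" using approx_ratio_le[OF sub(1) reg] reg1[OF reg] by simp
    show "1 \<le> approx_ratio regular_class"
      by (rule approx_ratio_ge[OF sub(1) reg]) (simp add: reg1)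
  qed
qed

end
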